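(* Let $(M^m,g)$ be a compact Riemannian manifold. A biharmonic map $\phi:(M^m,g)\to\mathbb{S}^{n+1}$ obtained as the composition of a minimal isometric immersion $\psi:(M^m,g)\to\mathbb{S}^n(\tfrac1{\sqrt2})$ and the tropical inclusion $\mathbf{i}:\mathbb{S}^n(\tfrac1{\sqrt2})\times\{\tfrac1{\sqrt2}\}\to\mathbb{S}^{n+1}$ has a strictly positive index, i.e. is unstable.
   Context: $\mathbb{S}^k(r)\subset\mathbb{R}^{k+1}$ is the sphere of radius $r$, $\mathbb{S}^k=\mathbb{S}^k(1)$. The tropical inclusion $\mathbf{i}$ is the inclusion of $\mathbb{S}^n(\tfrac1{\sqrt2})\cong\mathbb{S}^n(\tfrac1{\sqrt2})\times\{\tfrac1{\sqrt2}\}$ in $\mathbb{S}^{n+1}$, $x\mapsto(x,\tfrac1{\sqrt2})$. The map $\phi=\mathbf{i}\circ\psi$ is a non-harmonic biharmonic map, i.e. a critical point of $E^2(\phi)=\tfrac12\int_M|\tau(\phi)|^2v_g$, where $\tau(\phi)=\mathrm{trace}\nabla d\phi$. $\Delta^\phi=-\mathrm{trace}_g(\nabla^\phi\nabla^\phi-\nabla^\phi_\nabla)$ is the Laplacian on sections of $\phi^{-1}T\mathbb{S}^{n+1}$. The second variation operator of $E^2$ at $\phi$, on sections $V$ of $\phi^{-1}T\mathbb{S}^{n+1}$, is (writing $dV=\nabla^\phi V$, $d\tau(\phi)=\nabla^\phi\tau(\phi)$, traces taken over $M$) \begin{align*}I(V)&=\Delta^\phi(\Delta^\phi V)+\Delta^\phi\left(\mathrm{trace}\langle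 V,d\phi\cdot\rangle d\phi\cdot-|d\phi|^2V\right)+2\langle d\tau(\phi),d\phi\rangle V+|\tau(\phi)|^2V\\&-2\,\mathrm{trace}\langle V,d\tau(\phi)\cdot\rangle d\phi\cdot-2\,\mathrm{trace}\langle\tau(\phi),dV\cdot\rangle d\phi\cdot-\langle\tau(\phi),V\rangle\tau(\phi)+\mathrm{trace}\langle d\phi\cdot,\Delta^\phi V\rangle d\phi\cdot\\&+\mathrm{trace}\langle d\phi\cdot,\mathrm{trace}\langle V,d\phi\cdot\rangle d\phi\cdot\rangle d\phi\cdot-2|d\phi|^2\,\mathrm{trace}\langle d\phi\cdot,V\rangle d\phi\cdot+2\langle dV,d\phi\rangle\tau(\phi)-|d\phi|^2\Delta^\phi V+|d\phi|^4V,\end{align*} and $(I(V),W)=\int_M\langle I(V),W\rangle v_g$. The index of $\phi$ is the largest dimension of a vector space of smooth sections $V$ of $\phi^{-1}T\mathbb{S}^{n+1}$ on which $(I(V),V)<0$ for all $V\neq0$. A map of index zero is called stable, otherwise unstable. *)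

theory Defs
  imports "HOL-Analysis.Analysis" "HOL-Library.Function_Algebras" "HOL-Library.Extended_Nat"
begin

section \<open>Smooth functions on open subsets of a normed space\<close>

primrec Ck_on :: "nat \<Rightarrow> ('a::real_normed_vector \<Rightarrow> 'b::real_normed_vector) \<Rightarrow> 'a set \<Rightarrow> bool" where
  "Ck_on 0 f S \<longleftrightarrow> continuous_on S f"
| "Ck_on (Suc k) f S \<longleftrightarrow>
     (\<forall>x\<in>S. f differentiable at x) \<and> (\<forall>v. Ck_on k (\<lambda>x. frechet_derivative f (at x) v) S)"

definition smooth_on :: "('a::real_normed_vector \<Rightarrow> 'b::real_normed_vector) \<Rightarrow> 'a set \<Rightarrow> bool" where
  "smooth_on f S \<longleftrightarrow> (\<forall>k. Ck_on k f S)"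


section \<open>Riemannian manifolds\<close>

record ('p, 'm) chart =
  domain :: "'p set"
  coord :: "'p \<Rightarrow> real ^ 'm"

text \<open>The metric is given classically, by its matrix of components in every chart of the atlas.\<close>

record ('p, 'm) riem =
  points :: "'p set"
  atlas :: "('p, 'm) chart set"
  metric :: "('p, 'm) chart \<Rightarrow> 'p \<Rightarrow> real ^ 'm ^ 'm"

definition param :: "('p, 'm::finite) chart \<Rightarrow> real ^ 'm \<Rightarrow> 'p" where
  "param c = inv_into (domain c) (coord c)"

definition chart_image :: "('p, 'm::finite) chart \<Rightarrow> (real ^ 'm) set" where
  "chart_image c = coord c ` domain c"

definition transition_jacobian ::
    "('p, 'm::finite) chart \<Rightarrow> ('p, 'm) chart \<Rightarrow> 'p \<Rightarrow> real ^ 'm ^ 'm" where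
  "transition_jacobian c d p = matrix (frechet_derivative (coord d \<circ> param c) (at (coord c p)))"

text \<open>Manifolds carry the subspace topology of a Hausdorff space. Second countability is not
  listed, as it follows from compactness, which is assumed throughout.\<close>

definition smooth_manifold :: "('p::t2_space, 'm::finite) riem \<Rightarrow> bool" where
  "smooth_manifold X \<longleftrightarrow>
     (\<forall>c\<in>atlas X. openin (top_of_set (points X)) (domain c) \<and> open (chart_image c) \<and>
        homeomorphism (domain c) (chart_image c) (coord c) (param c)) \<and>
     (\<Union>c\<in>atlas X. domain c) = points X \<and>
     (\<forall>c\<in>atlas X. \<forall>d\<in>atlas X. smooth_on (coord d \<circ> param c) (coord c ` (domain c \<inter> domain d)))"

definition riemannian_metric :: "('p::t2_space, 'm::finite) riem \<Rightarrow> bool" where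
  "riemannian_metric X \<longleftrightarrow>
     (\<forall>c\<in>atlas X. smooth_on (metric X c \<circ> param c) (chart_image c)) \<and>
     (\<forall>c\<in>atlas X. \<forall>p\<in>domain c. transpose (metric X c p) = metric X c p \<and>
        (\<forall>v. v \<noteq> 0 \<longrightarrow> v \<bullet> (metric X c p *v v) > 0)) \<and>
     (\<forall>c\<in>atlas X. \<forall>d\<in>atlas X. \<forall>p\<in>domain c \<inter> domain d.
        metric X c p =
          transpose (transition_jacobian c d p) ** metric X d p ** transition_jacobian c d p)"

definition compact_riemannian_manifold :: "('p::t2_space, 'm::finite) riem \<Rightarrow> bool" where
  "compact_riemannian_manifold X \<longleftrightarrow>
     smooth_manifold X \<and> riemannian_metric X \<and> compact (points X)"

definition smooth_map :: "('p, 'm::finite) riem \<Rightarrow> ('p \<Rightarrow> 'b::real_normed_vector) \<Rightarrow> bool" where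
  "smooth_map X f \<longleftrightarrow> (\<forall>c\<in>atlas X. smooth_on (f \<circ> param c) (chart_image c))"

text \<open>Partial derivative along the \<open>i\<close>-th coordinate field of the chart \<open>c\<close>.\<close>

definition pd :: "('p, 'm::finite) chart \<Rightarrow> 'm \<Rightarrow> ('p \<Rightarrow> 'b::real_normed_vector) \<Rightarrow> 'p \<Rightarrow> 'b" where
  "pd c i f p = frechet_derivative (f \<circ> param c) (at (coord c p)) (axis i 1)"

definition metric_inv :: "('p, 'm::finite) riem \<Rightarrow> ('p, 'm) chart \<Rightarrow> 'p \<Rightarrow> real ^ 'm ^ 'm" where
  "metric_inv X c p = matrix_inv (metric X c p)"

text \<open>\<open>christoffel X c k i j\<close> is the symbol with upper index \<open>k\<close> and lower indices \<open>i\<close>, \<open>j\<close>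
  of the Levi-Civita connection.\<close>

definition christoffel ::
    "('p, 'm::finite) riem \<Rightarrow> ('p, 'm) chart \<Rightarrow> 'm \<Rightarrow> 'm \<Rightarrow> 'm \<Rightarrow> 'p \<Rightarrow> real" where
  "christoffel X c k i j p =
     (1/2) * (\<Sum>l\<in>UNIV. metric_inv X c p $ k $ l *
       (pd c i (\<lambda>q. metric X c q $ j $ l) p + pd c j (\<lambda>q. metric X c q $ i $ l) p
        - pd c l (\<lambda>q. metric X c q $ i $ j) p))"

text \<open>The trace with respect to the metric of a bilinear form on the tangent space at \<open>p\<close> that is
  given by its components in the chart \<open>c\<close>.\<close>

definition trace_in :: "('p, 'm::finite) riem \<Rightarrow> ('p, 'm) chart \<Rightarrow> 'p \<Rightarrow>
    ('m \<Rightarrow> 'm \<Rightarrow> 'b::real_vector) \<Rightarrow> 'b" where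
  "trace_in X c p B = (\<Sum>i\<in>UNIV. \<Sum>j\<in>UNIV. metric_inv X c p $ i $ j *\<^sub>R B i j)"

text \<open>All bilinear forms traced below are tensorial, so that the value of \<open>tr\<close> does not depend on
  the chart around \<open>p\<close> in which it is computed.\<close>

definition chart_at :: "('p, 'm::finite) riem \<Rightarrow> 'p \<Rightarrow> ('p, 'm) chart" where
  "chart_at X p = (SOME c. c \<in> atlas X \<and> p \<in> domain c)"

definition tr :: "('p, 'm::finite) riem \<Rightarrow> 'p \<Rightarrow>
    (('p, 'm) chart \<Rightarrow> 'm \<Rightarrow> 'm \<Rightarrow> 'b::real_vector) \<Rightarrow> 'b" where
  "tr X p B = trace_in X (chart_at X p) p (B (chart_at X p))"


section \<open>The Riemannian measure\<close>

text \<open>A compact manifold is the union of finitely many compact sets, each contained in a chart.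
  Made disjoint, they are Borel sets, and the measure is the sum over these of the integrals of the
  density \<open>sqrt (det g)\<close> in the respective coordinates. By the change of variables formula and the
  transformation law of the metric, it does not depend on the choice.\<close>

definition compact_chart_cover ::
    "('p::t2_space, 'm::finite) riem \<Rightarrow> (('p, 'm) chart \<times> 'p set) list \<Rightarrow> bool" where
  "compact_chart_cover X cs \<longleftrightarrow>
     (\<forall>(c, K) \<in> set cs. c \<in> atlas X \<and> compact K \<and> K \<subseteq> domain c) \<and>
     (\<Union>(c, K) \<in> set cs. K) = points X"

definition cover_measure :: "('p::t2_space, 'm::finite) riem \<Rightarrow>
    (('p, 'm) chart \<times> 'p set) list \<Rightarrow> 'p set \<Rightarrow> ennreal" where
  "cover_measure X cs A =
     (\<Sum>k<length cs. let c = fst (cs ! k); D = snd (cs ! k) - (\<Union>j<k. snd (cs ! j)) in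
        \<integral>\<^sup>+ u \<in> coord c ` (A \<inter> D). ennreal (sqrt (det (metric X c (param c u)))) \<partial>lborel)"

definition volume :: "('p::t2_space, 'm::finite) riem \<Rightarrow> 'p measure" where
  "volume X = measure_of (points X) (sets (restrict_space borel (points X)))
     (cover_measure X (SOME cs. compact_chart_cover X cs))"


section \<open>Maps into spheres centred at the origin\<close>

text \<open>A map into a sphere is regarded as a map \<open>f\<close> into the ambient Euclidean space, and a section
  of the pull-back of the tangent bundle of the sphere as a map \<open>V\<close> with \<open>V p\<close> orthogonal
  to \<open>f p\<close>. The Levi-Civita connection of a sphere is the tangential part of the flat one.\<close>

definition tangent_proj :: "'b::euclidean_space \<Rightarrow> 'b \<Rightarrow> 'b" where
  "tangent_proj y v = v - ((v \<bullet> y) / (y \<bullet> y)) *\<^sub>R y"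

text \<open>The pull-back connection along \<open>f\<close>, in the direction of the \<open>i\<close>-th coordinate field.\<close>

definition nabla :: "('p \<Rightarrow> 'b::euclidean_space) \<Rightarrow> ('p, 'm::finite) chart \<Rightarrow> 'm \<Rightarrow>
    ('p \<Rightarrow> 'b) \<Rightarrow> 'p \<Rightarrow> 'b" where
  "nabla f c i V p = tangent_proj (f p) (pd c i V p)"

text \<open>The components of \<open>\<nabla>df\<close> in the chart \<open>c\<close>.\<close>

definition nabla_d :: "('p, 'm::finite) riem \<Rightarrow> ('p \<Rightarrow> 'b::euclidean_space) \<Rightarrow> ('p, 'm) chart \<Rightarrow>
    'm \<Rightarrow> 'm \<Rightarrow> 'p \<Rightarrow> 'b" where
  "nabla_d X f c i j p =
     nabla f c i (pd c j f) p - (\<Sum>k\<in>UNIV. christoffel X c k i j p *\<^sub>R pd c k f p)"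

definition tension :: "('p, 'm::finite) riem \<Rightarrow> ('p \<Rightarrow> 'b::euclidean_space) \<Rightarrow> 'p \<Rightarrow> 'b" where
  "tension X f p = tr X p (\<lambda>c i j. nabla_d X f c i j p)"

definition laplacian :: "('p, 'm::finite) riem \<Rightarrow> ('p \<Rightarrow> 'b::euclidean_space) \<Rightarrow>
    ('p \<Rightarrow> 'b) \<Rightarrow> 'p \<Rightarrow> 'b" where
  "laplacian X f V p = - tr X p (\<lambda>c i j.
     nabla f c i (nabla f c j V) p - (\<Sum>k\<in>UNIV. christoffel X c k i j p *\<^sub>R nabla f c k V p))"


subsection \<open>Minimal isometric immersions\<close>

definition isometric_immersion ::
    "('p, 'm::finite) riem \<Rightarrow> real \<Rightarrow> ('p \<Rightarrow> 'b::euclidean_space) \<Rightarrow> bool" where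
  "isometric_immersion X r f \<longleftrightarrow>
     smooth_map X f \<and> f ` points X \<subseteq> sphere 0 r \<and>
     (\<forall>c\<in>atlas X. \<forall>p\<in>domain c. inj (frechet_derivative (f \<circ> param c) (at (coord c p))) \<and>
        (\<forall>i j. metric X c p $ i $ j = pd c i f p \<bullet> pd c j f p))"

text \<open>For an isometric immersion \<open>f\<close> into a sphere: the part of the covariant derivative (in the
  sphere) of the \<open>j\<close>-th coordinate field along the \<open>i\<close>-th one that is normal to \<open>f\<close>.\<close>

definition second_fundamental_form :: "('p, 'm::finite) riem \<Rightarrow> ('p \<Rightarrow> 'b::euclidean_space) \<Rightarrow>
    ('p, 'm) chart \<Rightarrow> 'm \<Rightarrow> 'm \<Rightarrow> 'p \<Rightarrow> 'b" where
  "second_fundamental_form X f c i j p =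
     (let w = nabla f c i (pd c j f) p
      in w - trace_in X c p (\<lambda>k l. (w \<bullet> pd c k f p) *\<^sub>R pd c l f p))"

definition mean_curvature ::
    "('p, 'm::finite) riem \<Rightarrow> ('p \<Rightarrow> 'b::euclidean_space) \<Rightarrow> 'p \<Rightarrow> 'b" where
  "mean_curvature X f p =
     (1 / real CARD('m)) *\<^sub>R tr X p (\<lambda>c i j. second_fundamental_form X f c i j p)"

definition minimal_isometric_immersion ::
    "('p, 'm::finite) riem \<Rightarrow> real \<Rightarrow> ('p \<Rightarrow> 'b::euclidean_space) \<Rightarrow> bool" where
  "minimal_isometric_immersion X r f \<longleftrightarrow>
     isometric_immersion X r f \<and> (\<forall>p\<in>points X. mean_curvature X f p = 0)"

definition tropical_inclusion :: "'a::euclidean_space \<Rightarrow> 'a \<times> real" where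
  "tropical_inclusion x = (x, 1 / sqrt 2)"


subsection \<open>Biharmonic maps into the unit sphere\<close>

definition harmonic :: "('p, 'm::finite) riem \<Rightarrow> ('p \<Rightarrow> 'b::euclidean_space) \<Rightarrow> bool" where
  "harmonic X f \<longleftrightarrow>
     smooth_map X f \<and> f ` points X \<subseteq> sphere 0 1 \<and> (\<forall>p\<in>points X. tension X f p = 0)"

definition bienergy :: "('p::t2_space, 'm::finite) riem \<Rightarrow> ('p \<Rightarrow> 'b::euclidean_space) \<Rightarrow> real" where
  "bienergy X f = (1/2) * (LINT p|volume X. (norm (tension X f p))\<^sup>2)"

definition smooth_variation :: "('p, 'm::finite) riem \<Rightarrow> ('p \<Rightarrow> 'b::euclidean_space) \<Rightarrow>
    (real \<Rightarrow> 'p \<Rightarrow> 'b) \<Rightarrow> bool" where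
  "smooth_variation X f F \<longleftrightarrow>
     (\<exists>e>0. (\<forall>c\<in>atlas X. smooth_on (\<lambda>(t, u). F t (param c u)) ({-e<..<e} \<times> chart_image c)) \<and>
        (\<forall>t\<in>{-e<..<e}. F t ` points X \<subseteq> sphere 0 1)) \<and>
     (\<forall>p\<in>points X. F 0 p = f p)"

definition biharmonic :: "('p::t2_space, 'm::finite) riem \<Rightarrow> ('p \<Rightarrow> 'b::euclidean_space) \<Rightarrow> bool" where
  "biharmonic X f \<longleftrightarrow>
     smooth_map X f \<and> f ` points X \<subseteq> sphere 0 1 \<and>
     (\<forall>F. smooth_variation X f F \<longrightarrow> ((\<lambda>t. bienergy X (F t)) has_real_derivative 0) (at 0))"


subsection \<open>Second variation and index\<close>

text \<open>\<open>energy_density X f\<close> is \<open>|df|\<^sup>2\<close>, without a factor \<open>1/2\<close>.\<close>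

definition energy_density :: "('p, 'm::finite) riem \<Rightarrow> ('p \<Rightarrow> 'b::euclidean_space) \<Rightarrow> 'p \<Rightarrow> real" where
  "energy_density X f p = tr X p (\<lambda>c i j. pd c i f p \<bullet> pd c j f p)"

text \<open>\<open>tr_d X f V\<close> is \<open>trace \<langle>V, df\<cdot>\<rangle> df\<cdot>\<close>.\<close>

definition tr_d :: "('p, 'm::finite) riem \<Rightarrow> ('p \<Rightarrow> 'b::euclidean_space) \<Rightarrow> ('p \<Rightarrow> 'b) \<Rightarrow> 'p \<Rightarrow> 'b" where
  "tr_d X f V p = tr X p (\<lambda>c i j. (V p \<bullet> pd c i f p) *\<^sub>R pd c j f p)"

definition nabla_inner_d ::
    "('p, 'm::finite) riem \<Rightarrow> ('p \<Rightarrow> 'b::euclidean_space) \<Rightarrow> ('p \<Rightarrow> 'b) \<Rightarrow> 'p \<Rightarrow> real" where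
  "nabla_inner_d X f V p = tr X p (\<lambda>c i j. nabla f c i V p \<bullet> pd c j f p)"

text \<open>\<open>tr_nabla_d X f V W\<close> is \<open>trace \<langle>V, \<nabla>W\<cdot>\<rangle> df\<cdot>\<close>.\<close>

definition tr_nabla_d ::
    "('p, 'm::finite) riem \<Rightarrow> ('p \<Rightarrow> 'b::euclidean_space) \<Rightarrow> ('p \<Rightarrow> 'b) \<Rightarrow> ('p \<Rightarrow> 'b) \<Rightarrow> 'p \<Rightarrow> 'b" where
  "tr_nabla_d X f V W p = tr X p (\<lambda>c i j. (V p \<bullet> nabla f c i W p) *\<^sub>R pd c j f p)"

definition second_variation ::
    "('p, 'm::finite) riem \<Rightarrow> ('p \<Rightarrow> 'b::euclidean_space) \<Rightarrow> ('p \<Rightarrow> 'b) \<Rightarrow> 'p \<Rightarrow> 'b" where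
  "second_variation X f V p =
     (let L = laplacian X f; \<tau> = tension X f; e = energy_density X f in
       L (L V) p
     + L (\<lambda>q. tr_d X f V q - e q *\<^sub>R V q) p
     + (2 * nabla_inner_d X f \<tau> p) *\<^sub>R V p
     + (norm (\<tau> p))\<^sup>2 *\<^sub>R V p
     - 2 *\<^sub>R tr_nabla_d X f V \<tau> p
     - 2 *\<^sub>R tr_nabla_d X f \<tau> V p
     - (\<tau> p \<bullet> V p) *\<^sub>R \<tau> p
     + tr_d X f (L V) p
     + tr_d X f (tr_d X f V) p
     - (2 * e p) *\<^sub>R tr_d X f V p
     + (2 * nabla_inner_d X f V p) *\<^sub>R \<tau> p
     - e p *\<^sub>R L V p
     + (e p)\<^sup>2 *\<^sub>R V p)"

text \<open>Sections are normalised to vanish off the manifold, so that distinct functions are distinct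
  sections and dimensions are counted correctly.\<close>

definition smooth_section ::
    "('p, 'm::finite) riem \<Rightarrow> ('p \<Rightarrow> 'b::euclidean_space) \<Rightarrow> ('p \<Rightarrow> 'b) \<Rightarrow> bool" where
  "smooth_section X f V \<longleftrightarrow>
     smooth_map X V \<and> (\<forall>p\<in>points X. V p \<bullet> f p = 0) \<and> (\<forall>p. p \<notin> points X \<longrightarrow> V p = 0)"

definition second_variation_form :: "('p::t2_space, 'm::finite) riem \<Rightarrow>
    ('p \<Rightarrow> 'b::euclidean_space) \<Rightarrow> ('p \<Rightarrow> 'b) \<Rightarrow> ('p \<Rightarrow> 'b) \<Rightarrow> real" where
  "second_variation_form X f V W = (LINT p|volume X. second_variation X f V p \<bullet> W p)"

definition scale_fun :: "real \<Rightarrow> ('p \<Rightarrow> 'b::real_vector) \<Rightarrow> 'p \<Rightarrow> 'b" where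
  "scale_fun r V = (\<lambda>p. r *\<^sub>R V p)"

global_interpretation fun_space: vector_space "scale_fun :: real \<Rightarrow> ('p \<Rightarrow> 'b::real_vector) \<Rightarrow> 'p \<Rightarrow> 'b"
  defines fun_subspace = fun_space.subspace
    and fun_span = fun_space.span
    and fun_dim = fun_space.dim
  by unfold_locales (auto simp: scale_fun_def fun_eq_iff scaleR_add_right scaleR_add_left)

definition negative_space :: "('p::t2_space, 'm::finite) riem \<Rightarrow> ('p \<Rightarrow> 'b::euclidean_space) \<Rightarrow>
    ('p \<Rightarrow> 'b) set \<Rightarrow> bool" where
  "negative_space X f S \<longleftrightarrow>
     fun_subspace S \<and> (\<forall>V\<in>S. smooth_section X f V) \<and>
     (\<forall>V\<in>S. V \<noteq> 0 \<longrightarrow> second_variation_form X f V V < 0)"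

text \<open>The library's dimension of an infinite-dimensional space is \<open>0\<close>, whence the restriction to
  finite-dimensional spaces; an infinite-dimensional negative space has subspaces of every finite
  dimension and gives the supremum \<open>\<infinity>\<close>.\<close>

definition index :: "('p::t2_space, 'm::finite) riem \<Rightarrow> ('p \<Rightarrow> 'b::euclidean_space) \<Rightarrow> enat" where
  "index X f =
     (SUP S \<in> {S. negative_space X f S \<and> (\<exists>B. finite B \<and> fun_span B = S)}. enat (fun_dim S))"

definition stable :: "('p::t2_space, 'm::finite) riem \<Rightarrow> ('p \<Rightarrow> 'b::euclidean_space) \<Rightarrow> bool" where
  "stable X f \<longleftrightarrow> index X f = 0"

abbreviation unstable :: "('p::t2_space, 'm::finite) riem \<Rightarrow> ('p \<Rightarrow> 'b::euclidean_space) \<Rightarrow> bool" where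
  "unstable X f \<equiv> \<not> stable X f"

end

theory Submission
  imports Defs
begin

text \<open>Write \<open>\<phi> = (\<psi>, 1 / sqrt 2)\<close> and let \<open>\<eta> = (\<psi>, - 1 / sqrt 2)\<close>, the unit normal of the tropical
  sphere in the unit sphere, taken along \<open>\<psi>\<close>. This section alone spans a space on which the second
  variation is negative definite.

  Since \<open>\<eta>\<close> and \<open>\<phi>\<close> differ by a constant vector and \<open>d\<phi>\<close> is tangent to the unit sphere,
  \<open>\<nabla>\<eta> = d\<phi>\<close>. Hence \<open>\<Delta>\<eta> = - \<tau>(\<phi>)\<close>. A minimal \<open>\<psi>\<close> has \<open>\<tau>(\<psi>) = 0\<close>
  (lemma \<open>minimal_imp_tension_zero\<close>), and comparing the spheres of radius \<open>1 / sqrt 2\<close> and \<open>1\<close> gives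
  \<open>\<tau>(\<phi>) = - m \<eta>\<close> (lemma \<open>tension_tropical\<close>), where \<open>m\<close> is the dimension of the manifold.
  As moreover \<open>|d\<phi>|\<^sup>2 = m\<close> and \<open>\<eta>\<close> is orthogonal to the image of \<open>d\<phi>\<close>, every term of the second
  variation operator at \<open>\<eta>\<close> is a multiple of \<open>m\<^sup>2 \<eta>\<close> or zero, and they add up to
  \<open>I(\<eta>) = - 4 m\<^sup>2 \<eta>\<close> (lemma \<open>second_variation_normal\<close>). Thus
  \<open>(I(\<eta>), \<eta>) = - 4 m\<^sup>2 Vol(M)\<close>.

  That \<open>\<tau>(\<psi>) = 0\<close> amounts to the Gauss formula: the correction of \<open>\<nabla>d\<psi>\<close> by the Christoffel symbols
  is exactly the tangential part that is removed in the second fundamental form. This rests on the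
  symmetry of second derivatives (lemma \<open>mixed_derivatives_commute\<close>).

  It remains to see that the volume is finite and positive. It is finite because the manifold is
  covered by finitely many compact pieces of charts, on which the density is bounded. If it vanished,
  then, the density being positive, all pieces would be null sets in their own charts, and in every
  other chart too, as transition maps are differentiable; but then the image of a chart would be a
  null set, although it is open (lemma \<open>cover_measure_nonzero\<close>). The manifold is nonempty because
  \<open>\<phi>\<close> is not harmonic.\<close>

section \<open>Functions of class C^k\<close>

lemma frechet_derivative_cong_open:
  assumes "open S" "x \<in> S" "\<And>y. y \<in> S \<Longrightarrow> f y = g y"
  shows "frechet_derivative f (at x) = frechet_derivative g (at x)"
proof -
  have "(f has_derivative D) (at x) \<longleftrightarrow> (g has_derivative D) (at x)" for D
    using assms by (metis has_derivative_transform_within_open)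
  then show ?thesis
    by (simp add: frechet_derivative_def)
qed

lemma differentiable_cong_open:
  assumes "f differentiable at x" "open S" "x \<in> S" "\<And>y. y \<in> S \<Longrightarrow> f y = g y"
  shows "g differentiable at x"
  using assms unfolding differentiable_def by (metis has_derivative_transform_within_open)

lemma Ck_on_cong:
  assumes "open S" "\<And>x. x \<in> S \<Longrightarrow> f x = g x" "Ck_on k f S"
  shows "Ck_on k g S"
  using assms(2,3)
proof (induction k arbitrary: f g)
  case 0
  then show ?case using continuous_on_cong by force
next
  case (Suc k)
  have eq: "frechet_derivative f (at x) v = frechet_derivative g (at x) v" if "x \<in> S" for x v
    using frechet_derivative_cong_open[OF assms(1) that Suc.prems(1)] by simp
  show ?case
    using Suc.prems differentiable_cong_open[OF _ assms(1) _ Suc.prems(1)]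
      Suc.IH[OF eq] by auto
qed

lemma Ck_on_affine:
  assumes "open S" "bounded_linear L" "Ck_on k f S"
  shows "Ck_on k (\<lambda>x. L (f x) + b) S"
  using assms(3)
proof (induction k arbitrary: f b)
  case 0
  then show ?case
    by (auto intro!: continuous_on_add continuous_on_const bounded_linear.continuous_on[OF assms(2)])
next
  case (Suc k)
  have D: "((\<lambda>x. L (f x) + b) has_derivative (\<lambda>v. L (frechet_derivative f (at x) v))) (at x)"
    if "x \<in> S" for x
  proof -
    have "(f has_derivative frechet_derivative f (at x)) (at x)"
      using Suc.prems that frechet_derivative_works by auto
    from bounded_linear.has_derivative[OF assms(2) this] show ?thesis
      by (rule has_derivative_add_const)
  qed
  have "Ck_on k (\<lambda>x. frechet_derivative (\<lambda>x. L (f x) + b) (at x) v) S" for v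
  proof (rule Ck_on_cong[OF assms(1)])
    show "Ck_on k (\<lambda>x. L (frechet_derivative f (at x) v) + 0) S"
      by (rule Suc.IH) (use Suc.prems in auto)
    show "L (frechet_derivative f (at x) v) + 0 = frechet_derivative (\<lambda>x. L (f x) + b) (at x) v"
      if "x \<in> S" for x
      using frechet_derivative_at[OF D[OF that]] by (metis add.right_neutral)
  qed
  then show ?case
    using differentiableI[OF D] by simp
qed

text \<open>The second difference of \<open>h\<close> over a parallelogram is a value of a mixed derivative, by two
  applications of the mean value theorem.\<close>

lemma mixed_increment:
  fixes h :: "'a::real_normed_vector \<Rightarrow> real"
  assumes S: "Ck_on 2 h S" and s: "0 < s"
    and sub: "\<And>a b. \<lbrakk>0 \<le> a; a \<le> s; 0 \<le> b; b \<le> s\<rbrakk> \<Longrightarrow> x + a *\<^sub>R v + b *\<^sub>R w \<in> S"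
  shows "\<exists>a\<in>{0..s}. \<exists>b\<in>{0..s}.
    h (x + s *\<^sub>R v + s *\<^sub>R w) - h (x + s *\<^sub>R v) - h (x + s *\<^sub>R w) + h x =
      s\<^sup>2 * frechet_derivative (\<lambda>y. frechet_derivative h (at y) v) (at (x + a *\<^sub>R v + b *\<^sub>R w)) w"
proof -
  let ?D = "\<lambda>y. frechet_derivative h (at y)"
  let ?DD = "\<lambda>y. frechet_derivative (\<lambda>y. ?D y v) (at y)"
  have d1: "(h has_derivative ?D y) (at y)" if "y \<in> S" for y
    using S that frechet_derivative_works by (auto simp: numeral_2_eq_2)
  have d2: "((\<lambda>y. ?D y v) has_derivative ?DD y) (at y)" if "y \<in> S" for y
    using S that frechet_derivative_works by (fastforce simp: numeral_2_eq_2)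
  have comp: "((\<lambda>t. f (z + t *\<^sub>R u)) has_derivative (\<lambda>t. F' (t *\<^sub>R u))) (at t within A)"
    if "(f has_derivative F') (at (z + t *\<^sub>R u))" for f :: "'a \<Rightarrow> real" and F' z u t A
    by (rule has_derivative_compose[where f="\<lambda>t. z + t *\<^sub>R u" and g=f, OF _ that])
      (auto intro!: derivative_eq_intros)
  define k where "k t = h (x + t *\<^sub>R v + s *\<^sub>R w) - h (x + t *\<^sub>R v)" for t
  have "(k has_derivative (\<lambda>r. ?D (x + t *\<^sub>R v + s *\<^sub>R w) (r *\<^sub>R v) - ?D (x + t *\<^sub>R v) (r *\<^sub>R v)))
      (at t within {0..s})" if "0 \<le> t" "t \<le> s" for t
  proof -
    have "x + s *\<^sub>R w + t *\<^sub>R v \<in> S" "x + t *\<^sub>R v \<in> S"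
      using sub[of t s] sub[of t 0] that s by (auto simp: add_ac)
    note comp[OF d1, OF this(1)] comp[OF d1, OF this(2)]
    from has_derivative_diff[OF this] show ?thesis
      by (simp add: k_def[abs_def] add_ac)
  qed
  from mvt_simple[OF s, of k, OF this] obtain a where a: "0 < a" "a < s"
    "k s - k 0 = ?D (x + a *\<^sub>R v + s *\<^sub>R w) (s *\<^sub>R v) - ?D (x + a *\<^sub>R v) (s *\<^sub>R v)"
    by auto
  have lin: "?D y (s *\<^sub>R v) = s * ?D y v" if "y \<in> S" for y
    using linear_cmul[OF has_derivative_linear[OF d1[OF that]]] by simp
  have "((\<lambda>t. ?D (x + a *\<^sub>R v + t *\<^sub>R w) v) has_derivative
      (\<lambda>r. ?DD (x + a *\<^sub>R v + t *\<^sub>R w) (r *\<^sub>R w))) (at t within {0..s})"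
    if "0 \<le> t" "t \<le> s" for t
    by (rule comp[OF d2]) (use sub[of a t] a that in auto)
  from mvt_simple[OF s this] obtain b where b: "0 < b" "b < s"
    "?D (x + a *\<^sub>R v + s *\<^sub>R w) v - ?D (x + a *\<^sub>R v + 0 *\<^sub>R w) v = ?DD (x + a *\<^sub>R v + b *\<^sub>R w) (s *\<^sub>R w)"
    by auto
  have "x + a *\<^sub>R v + b *\<^sub>R w \<in> S" "x + a *\<^sub>R v + s *\<^sub>R w \<in> S" "x + a *\<^sub>R v \<in> S"
    using sub[of a b] sub[of a s] sub[of a 0] a b by auto
  then have "k s - k 0 = s * (s * ?DD (x + a *\<^sub>R v + b *\<^sub>R w) w)"
    using a b lin linear_cmul[OF has_derivative_linear[OF d2]]
    by (simp add: right_diff_distrib[symmetric])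
  then show ?thesis
    using a b by (intro bexI[of _ a] bexI[of _ b]) (auto simp: k_def power2_eq_square)
qed

text \<open>Schwarz's theorem: the second difference of \<open>h\<close> over a small parallelogram is, up to the factor
  \<open>s\<^sup>2\<close>, a value of either mixed derivative near \<open>x\<close>, and these derivatives are continuous.\<close>

lemma mixed_derivatives_commute_real:
  fixes h :: "'a::real_normed_vector \<Rightarrow> real"
  assumes S: "Ck_on 2 h S" "open S" and x: "x \<in> S"
  shows "frechet_derivative (\<lambda>y. frechet_derivative h (at y) v) (at x) w =
         frechet_derivative (\<lambda>y. frechet_derivative h (at y) w) (at x) v"
proof -
  define P where "P y = frechet_derivative (\<lambda>y. frechet_derivative h (at y) v) (at y) w" for y
  define Q where "Q y = frechet_derivative (\<lambda>y. frechet_derivative h (at y) w) (at y) v" for y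
  have cP: "isCont P x" and cQ: "isCont Q x"
    unfolding P_def[abs_def] Q_def[abs_def]
    using S x by (auto simp: numeral_2_eq_2 continuous_on_eq_continuous_at)
  have "\<bar>P x - Q x\<bar> \<le> e" if "e > 0" for e
  proof -
    obtain d where d: "d > 0" "ball x d \<subseteq> S"
      "\<And>y. dist y x < d \<Longrightarrow> \<bar>P y - P x\<bar> < e/2" "\<And>y. dist y x < d \<Longrightarrow> \<bar>Q y - Q x\<bar> < e/2"
    proof -
      obtain d1 where "d1 > 0" "ball x d1 \<subseteq> S" using S x openE by blast
      moreover obtain d2 where "d2 > 0" "\<And>y. dist y x < d2 \<Longrightarrow> \<bar>P y - P x\<bar> < e/2"
        using cP[unfolded continuous_at_eps_delta, rule_format, of "e/2"] \<open>e > 0\<close> by (auto simp: dist_real_def)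
      moreover obtain d3 where "d3 > 0" "\<And>y. dist y x < d3 \<Longrightarrow> \<bar>Q y - Q x\<bar> < e/2"
        using cQ[unfolded continuous_at_eps_delta, rule_format, of "e/2"] \<open>e > 0\<close> by (auto simp: dist_real_def)
      ultimately show ?thesis
        by (intro that[of "min d1 (min d2 d3)"]) (auto simp: subset_iff)
    qed
    (* the parallelogram with sides s v and s w lies in the ball of radius d *)
    define s where "s = d / (norm v + norm w + 1)"
    have pos: "norm v + norm w + 1 > 0"
      by (simp add: add_nonneg_pos)
    then have s: "0 < s" "s * (norm v + norm w) < d"
      using d(1) by (simp_all add: s_def divide_simps mult.commute)
    have near: "dist (x + a *\<^sub>R v + b *\<^sub>R w) x < d" "dist (x + b *\<^sub>R w + a *\<^sub>R v) x < d"
      if "0 \<le> a" "a \<le> s" "0 \<le> b" "b \<le> s" for a b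
    proof -
      have "dist (x + a *\<^sub>R v + b *\<^sub>R w) x \<le> a * norm v + b * norm w"
        using norm_triangle_ineq[of "a *\<^sub>R v" "b *\<^sub>R w"] that by (simp add: dist_norm add.assoc)
      also have "\<dots> \<le> s * (norm v + norm w)"
        using that by (simp add: distrib_left add_mono mult_right_mono)
      finally show "dist (x + a *\<^sub>R v + b *\<^sub>R w) x < d" using s by simp
      then show "dist (x + b *\<^sub>R w + a *\<^sub>R v) x < d" by (simp add: add_ac)
    qed
    then have sub: "x + a *\<^sub>R v + b *\<^sub>R w \<in> S" "x + b *\<^sub>R w + a *\<^sub>R v \<in> S"
      if "0 \<le> a" "a \<le> s" "0 \<le> b" "b \<le> s" for a b
      using that d(2) by (auto simp: dist_commute subset_iff)
    obtain a b where ab: "a \<in> {0..s}" "b \<in> {0..s}"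
      "h (x + s *\<^sub>R v + s *\<^sub>R w) - h (x + s *\<^sub>R v) - h (x + s *\<^sub>R w) + h x = s\<^sup>2 * P (x + a *\<^sub>R v + b *\<^sub>R w)"
      using mixed_increment[OF S(1) s(1) sub(1), folded P_def] by blast
    obtain a' b' where ab': "a' \<in> {0..s}" "b' \<in> {0..s}"
      "h (x + s *\<^sub>R w + s *\<^sub>R v) - h (x + s *\<^sub>R w) - h (x + s *\<^sub>R v) + h x = s\<^sup>2 * Q (x + a' *\<^sub>R w + b' *\<^sub>R v)"
      using mixed_increment[OF S(1) s(1) sub(2), folded Q_def] by blast
    have swap: "x + s *\<^sub>R w + s *\<^sub>R v = x + s *\<^sub>R v + s *\<^sub>R w"
      by (simp add: add_ac)
    have "s\<^sup>2 * P (x + a *\<^sub>R v + b *\<^sub>R w) = s\<^sup>2 * Q (x + a' *\<^sub>R w + b' *\<^sub>R v)"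
      using ab(3) ab'(3)[unfolded swap] by linarith
    then have "P (x + a *\<^sub>R v + b *\<^sub>R w) = Q (x + a' *\<^sub>R w + b' *\<^sub>R v)"
      using s by simp
    moreover have "\<bar>P (x + a *\<^sub>R v + b *\<^sub>R w) - P x\<bar> < e/2"
      by (rule d(3), rule near(1)) (use ab in auto)
    moreover have "\<bar>Q (x + a' *\<^sub>R w + b' *\<^sub>R v) - Q x\<bar> < e/2"
      by (rule d(4), rule near(2)) (use ab' in auto)
    ultimately show ?thesis by linarith
  qed
  then have "\<bar>P x - Q x\<bar> \<le> 0"
    by (rule field_le_epsilon) simp
  then show ?thesis by (simp add: P_def Q_def)
qed

lemma Ck_on_differentiable:
  assumes "Ck_on (Suc k) f S" "x \<in> S"
  shows "f differentiable at x"
  using assms by simp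

lemma frechet_derivative_bounded_linear:
  assumes "bounded_linear L" "f differentiable at x"
  shows "frechet_derivative (\<lambda>y. L (f y)) (at x) v = L (frechet_derivative f (at x) v)"
  using bounded_linear.has_derivative[OF assms(1) assms(2)[unfolded frechet_derivative_works]]
    frechet_derivative_at by metis

lemma mixed_derivatives_commute:
  fixes f :: "'a::real_normed_vector \<Rightarrow> 'b::euclidean_space"
  assumes S: "Ck_on 2 f S" "open S" and x: "x \<in> S"
  shows "frechet_derivative (\<lambda>y. frechet_derivative f (at y) v) (at x) w =
         frechet_derivative (\<lambda>y. frechet_derivative f (at y) w) (at x) v"
proof (rule euclidean_eqI)
  fix b :: 'b
  let ?L = "\<lambda>z. z \<bullet> b"
  have L: "bounded_linear ?L" by (rule bounded_linear_inner_left)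
  have C: "Ck_on 2 (\<lambda>y. f y \<bullet> b) S"
    using Ck_on_affine[OF S(2) L S(1), of 0] by simp
  have *: "frechet_derivative (\<lambda>y. frechet_derivative (\<lambda>y. f y \<bullet> b) (at y) u) (at x) u' =
        frechet_derivative (\<lambda>y. frechet_derivative f (at y) u) (at x) u' \<bullet> b" for u u'
  proof -
    have "frechet_derivative (\<lambda>y. frechet_derivative (\<lambda>y. f y \<bullet> b) (at y) u) (at x) u' =
          frechet_derivative (\<lambda>y. frechet_derivative f (at y) u \<bullet> b) (at x) u'"
      by (rule fun_cong, rule frechet_derivative_cong_open[OF S(2) x], rule frechet_derivative_bounded_linear[OF L])
        (use S in \<open>auto simp: numeral_2_eq_2\<close>)
    also have "\<dots> = frechet_derivative (\<lambda>y. frechet_derivative f (at y) u) (at x) u' \<bullet> b"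
      by (rule frechet_derivative_bounded_linear[OF L]) (use S x in \<open>auto simp: numeral_2_eq_2\<close>)
    finally show ?thesis .
  qed
  show "frechet_derivative (\<lambda>y. frechet_derivative f (at y) v) (at x) w \<bullet> b =
        frechet_derivative (\<lambda>y. frechet_derivative f (at y) w) (at x) v \<bullet> b"
    using mixed_derivatives_commute_real[OF C S(2) x, of v w] * by simp
qed

section \<open>Calculus in a chart\<close>

text \<open>Differentiability at a point of a map on the manifold, expressed in the chart \<open>c\<close>.\<close>

abbreviation diff_in_chart :: "('p, 'm::finite) chart \<Rightarrow> ('p \<Rightarrow> 'b::real_normed_vector) \<Rightarrow> 'p \<Rightarrow> bool" where
  "diff_in_chart c F p \<equiv> (F \<circ> param c) differentiable at (coord c p)"

lemma chart_at:
  assumes "smooth_manifold X" "p \<in> points X"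
  shows "chart_at X p \<in> atlas X" "p \<in> domain (chart_at X p)"
proof -
  have "\<exists>c. c \<in> atlas X \<and> p \<in> domain c"
    using assms by (auto simp: smooth_manifold_def)
  then have "chart_at X p \<in> atlas X \<and> p \<in> domain (chart_at X p)"
    unfolding chart_at_def by (rule someI_ex)
  then show "chart_at X p \<in> atlas X" "p \<in> domain (chart_at X p)" by auto
qed

lemma pd_affine:
  assumes "bounded_linear L" "diff_in_chart c F p"
  shows "pd c i (\<lambda>q. L (F q) + b) p = L (pd c i F p)"
proof -
  have "((\<lambda>u. L ((F \<circ> param c) u) + b) has_derivative
      (\<lambda>v. L (frechet_derivative (F \<circ> param c) (at (coord c p)) v))) (at (coord c p))"
    using bounded_linear.has_derivative[OF assms(1) assms(2)[unfolded frechet_derivative_works]]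
    by (rule has_derivative_add_const)
  then have D: "((\<lambda>q. L (F q) + b) \<circ> param c has_derivative
      (\<lambda>v. L (frechet_derivative (F \<circ> param c) (at (coord c p)) v))) (at (coord c p))"
    by (simp add: o_def)
  show "pd c i (\<lambda>q. L (F q) + b) p = L (pd c i F p)"
    unfolding pd_def frechet_derivative_at[OF D, symmetric] ..
qed

lemma pd_scaleR:
  assumes "diff_in_chart c F p"
  shows "pd c i (\<lambda>q. a *\<^sub>R F q) p = a *\<^sub>R pd c i F p"
  using pd_affine[OF bounded_linear_scaleR_right assms, of i a 0] by simp

lemma pd_const: "pd c i (\<lambda>q. b) p = 0"
  by (simp add: pd_def o_def)

context
  fixes X :: "('p::t2_space, 'm::finite) riem" and c :: "('p, 'm) chart"
  assumes X: "smooth_manifold X" and c: "c \<in> atlas X"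
begin

lemma chart_homeomorphism: "homeomorphism (domain c) (chart_image c) (coord c) (param c)"
  and open_chart_image: "open (chart_image c)"
  and openin_domain: "openin (top_of_set (points X)) (domain c)"
  using X c by (auto simp: smooth_manifold_def)

lemma domain_subset_points: "domain c \<subseteq> points X"
  using openin_domain openin_imp_subset by blast

lemma coord_in_chart_image: "p \<in> domain c \<Longrightarrow> coord c p \<in> chart_image c"
  by (simp add: chart_image_def)

lemma param_coord: "p \<in> domain c \<Longrightarrow> param c (coord c p) = p"
  using chart_homeomorphism by (simp add: homeomorphism_def)

lemma coord_param: "u \<in> chart_image c \<Longrightarrow> coord c (param c u) = u"
  using chart_homeomorphism by (simp add: homeomorphism_def)

lemma param_in_domain: "u \<in> chart_image c \<Longrightarrow> param c u \<in> domain c"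
  using chart_homeomorphism by (auto simp: homeomorphism_def)

lemma pd_cong:
  assumes "p \<in> domain c" "\<And>q. q \<in> domain c \<Longrightarrow> F q = G q"
  shows "pd c i F p = pd c i G p"
  unfolding pd_def
  by (rule fun_cong, rule frechet_derivative_cong_open[OF open_chart_image])
    (use assms coord_in_chart_image param_in_domain in auto)

lemma pd_inner:
  fixes F G :: "'p \<Rightarrow> 'b::real_inner"
  assumes p: "p \<in> domain c" and "diff_in_chart c F p" "diff_in_chart c G p"
  shows "pd c i (\<lambda>q. F q \<bullet> G q) p = F p \<bullet> pd c i G p + pd c i F p \<bullet> G p"
proof -
  have "((\<lambda>q. F q \<bullet> G q) \<circ> param c has_derivative
     (\<lambda>v. (F \<circ> param c) (coord c p) \<bullet> frechet_derivative (G \<circ> param c) (at (coord c p)) v +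
          frechet_derivative (F \<circ> param c) (at (coord c p)) v \<bullet> (G \<circ> param c) (coord c p))) (at (coord c p))"
    using has_derivative_inner[OF assms(2,3)[unfolded frechet_derivative_works]]
    by (simp add: o_def)
  from frechet_derivative_at[OF this, symmetric] show ?thesis
    by (simp add: pd_def param_coord[OF p])
qed

lemma pd_comp_param:
  "u \<in> chart_image c \<Longrightarrow> (pd c j F \<circ> param c) u = frechet_derivative (F \<circ> param c) (at u) (axis j 1)"
  by (simp add: pd_def coord_param)

context
  fixes F :: "'p \<Rightarrow> 'b::euclidean_space"
  assumes F: "smooth_map X F"
begin

lemma Ck_on_in_chart: "Ck_on k (F \<circ> param c) (chart_image c)"
  using F c by (auto simp: smooth_map_def smooth_on_def)

context
  fixes p
  assumes p: "p \<in> domain c"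
begin

lemma smooth_map_diff_in_chart: "diff_in_chart c F p"
  using Ck_on_in_chart[of 1] coord_in_chart_image[OF p] by simp

lemma pd_diff_in_chart: "diff_in_chart c (pd c j F) p"
proof -
  have "(\<lambda>u. frechet_derivative (F \<circ> param c) (at u) (axis j 1)) differentiable at (coord c p)"
    using Ck_on_in_chart[of 2] coord_in_chart_image[OF p] by (auto simp: numeral_2_eq_2)
  then show ?thesis
    by (rule differentiable_cong_open[OF _ open_chart_image coord_in_chart_image[OF p]])
      (simp only: pd_comp_param)
qed

lemma pd_commute: "pd c i (pd c j F) p = pd c j (pd c i F) p"
proof -
  have *: "pd c i (pd c j F) p = frechet_derivative
      (\<lambda>u. frechet_derivative (F \<circ> param c) (at u) (axis j 1)) (at (coord c p)) (axis i 1)" for i j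
    unfolding pd_def[of c i]
    by (rule fun_cong, rule frechet_derivative_cong_open[OF open_chart_image coord_in_chart_image[OF p]])
      (simp only: pd_comp_param)
  show ?thesis
    unfolding * by (rule mixed_derivatives_commute[OF Ck_on_in_chart open_chart_image coord_in_chart_image[OF p]])
qed

end

end

subsection \<open>Maps into a sphere\<close>

context
  fixes f :: "'p \<Rightarrow> 'b::euclidean_space" and r
  assumes f: "smooth_map X f" "f ` points X \<subseteq> sphere 0 r"
begin

lemma sphere_inner_self: "p \<in> domain c \<Longrightarrow> f p \<bullet> f p = r\<^sup>2"
  using f(2) domain_subset_points by (force simp: dot_square_norm)

lemma sphere_inner_pd:
  assumes p: "p \<in> domain c"
  shows "f p \<bullet> pd c i f p = 0" "pd c i f p \<bullet> f p = 0"
proof -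
  have "pd c i (\<lambda>q. f q \<bullet> f q) p = pd c i (\<lambda>q. r\<^sup>2) p"
    by (rule pd_cong[OF p sphere_inner_self])
  then show "f p \<bullet> pd c i f p = 0"
    using pd_inner[OF p smooth_map_diff_in_chart[OF f(1) p] smooth_map_diff_in_chart[OF f(1) p], of i]
    by (simp add: pd_const inner_commute)
  then show "pd c i f p \<bullet> f p = 0" by (simp add: inner_commute)
qed

end

lemma sphere_inner_pd_pd:
  fixes f :: "'p \<Rightarrow> 'b::euclidean_space"
  assumes f: "smooth_map X f" "f ` points X \<subseteq> sphere 0 r" and p: "p \<in> domain c"
  shows "pd c i (pd c j f) p \<bullet> f p = - (pd c i f p \<bullet> pd c j f p)"
proof -
  have "pd c i (\<lambda>q. f q \<bullet> pd c j f q) p = pd c i (\<lambda>q. 0) p"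
    by (rule pd_cong[OF p sphere_inner_pd(1)[OF f]])
  then show ?thesis
    using pd_inner[OF p smooth_map_diff_in_chart[OF f(1) p] pd_diff_in_chart[OF f(1) p, of j], of i]
    by (simp add: pd_const inner_commute)
qed

end

section \<open>Positive definite matrices and traces\<close>

lemma transpose_eq_self_nth: "transpose A = A \<Longrightarrow> A $ i $ j = A $ j $ i"
  by (simp add: transpose_def vec_eq_iff)

lemma matrix_inv_pos_def:
  fixes A :: "real^'n^'n"
  assumes A: "transpose A = A" "\<And>v. v \<noteq> 0 \<Longrightarrow> v \<bullet> (A *v v) > 0"
  shows "matrix_inv A ** A = mat 1" "transpose (matrix_inv A) = matrix_inv A"
proof -
  have "\<exists>B. B ** A = mat 1"
    unfolding matrix_left_invertible_ker using A(2) by force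
  then obtain B where B: "A ** B = mat 1 \<and> B ** A = mat 1"
    using matrix_left_right_inverse by blast
  then have inv: "A ** matrix_inv A = mat 1 \<and> matrix_inv A ** A = mat 1"
    unfolding matrix_inv_def by (rule someI)
  then show "matrix_inv A ** A = mat 1" by simp
  have "transpose (matrix_inv A) ** A = mat 1"
    using inv A(1) by (metis matrix_transpose_mul transpose_mat)
  then show "transpose (matrix_inv A) = matrix_inv A"
    using inv by (metis matrix_mul_assoc matrix_mul_lid matrix_mul_rid)
qed

text \<open>The segment from the identity to a positive definite matrix contains no singular matrix.\<close>

lemma det_pos_def:
  fixes A :: "real^'n^'n"
  assumes A: "\<And>v. v \<noteq> 0 \<Longrightarrow> v \<bullet> (A *v v) > 0"
  shows "det A > 0"
proof -
  define B where "B t = (1 - t) *\<^sub>R mat 1 + t *\<^sub>R A" for t :: real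
  have nz: "det (B t) \<noteq> 0" if "0 \<le> t" "t \<le> 1" for t
  proof -
    have "v = 0" if v: "B t *v v = 0" for v
    proof (rule ccontr)
      assume "v \<noteq> 0"
      have "0 = v \<bullet> (B t *v v)" using v by simp
      also have "\<dots> = (1 - t) * (v \<bullet> v) + t * (v \<bullet> (A *v v))"
        by (simp add: B_def matrix_vector_mult_add_rdistrib scaleR_matrix_vector_assoc[symmetric] inner_add_right)
      also have "\<dots> > 0"
        using A[OF \<open>v \<noteq> 0\<close>] \<open>v \<noteq> 0\<close> \<open>0 \<le> t\<close> \<open>t \<le> 1\<close>
        by (cases "t = 0") (auto intro: add_nonneg_pos)
      finally show False by simp
    qed
    then have "invertible (B t)"
      using invertible_left_inverse matrix_left_invertible_ker by blast
    then show ?thesis using invertible_det_nz by blast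
  qed
  have cont: "continuous_on {0..1} (\<lambda>t. det (B t))"
    unfolding det_def B_def by (intro continuous_intros)
  have "det (B 0) = 1" "det (B 1) = det A" by (simp_all add: B_def)
  show ?thesis
  proof (rule ccontr)
    assume "\<not> det A > 0"
    then have "\<exists>t\<ge>0. t \<le> 1 \<and> det (B t) = 0"
      using IVT2'[of "\<lambda>t. det (B t)" 1 0 0] cont \<open>det (B 0) = 1\<close> \<open>det (B 1) = det A\<close> by auto
    then show False using nz by auto
  qed
qed

context
  fixes X :: "('p::t2_space, 'm::finite) riem" and c :: "('p, 'm) chart" and p
  assumes X: "riemannian_metric X" and c: "c \<in> atlas X" and p: "p \<in> domain c"
begin

lemma metric_transpose: "transpose (metric X c p) = metric X c p"
  and metric_pos_def: "v \<noteq> 0 \<Longrightarrow> v \<bullet> (metric X c p *v v) > 0"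
  using X c p unfolding riemannian_metric_def by blast+

lemma metric_sym: "metric X c p $ i $ j = metric X c p $ j $ i"
  by (rule transpose_eq_self_nth[OF metric_transpose])

lemma metric_inv_sym: "metric_inv X c p $ i $ j = metric_inv X c p $ j $ i"
  unfolding metric_inv_def
  by (rule transpose_eq_self_nth[OF matrix_inv_pos_def(2)[OF metric_transpose metric_pos_def]])

lemma metric_inv_metric: "metric_inv X c p ** metric X c p = mat 1"
  unfolding metric_inv_def by (rule matrix_inv_pos_def(1)[OF metric_transpose metric_pos_def])

lemma trace_metric: "trace_in X c p (\<lambda>i j. metric X c p $ i $ j) = real CARD('m)"
proof -
  have "(metric_inv X c p ** metric X c p) $ i $ i = 1" for i
    by (simp add: metric_inv_metric mat_def)
  then have "(\<Sum>j\<in>UNIV. metric_inv X c p $ i $ j * metric X c p $ i $ j) = 1" for i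
    using metric_sym[of i] by (simp add: matrix_matrix_mult_def)
  then show ?thesis
    by (simp add: trace_in_def)
qed

end

lemma trace_in_add: "trace_in X c p (\<lambda>i j. B i j + C i j) = trace_in X c p B + trace_in X c p C"
  by (simp add: trace_in_def scaleR_add_right sum.distrib)

lemma trace_in_linear:
  assumes "linear L"
  shows "trace_in X c p (\<lambda>i j. L (B i j)) = L (trace_in X c p B)"
  by (simp add: trace_in_def linear_sum[OF assms] linear_cmul[OF assms])

section \<open>Minimal immersions into a sphere have no tension\<close>

context
  fixes X :: "('p::t2_space, 'm::finite) riem" and f :: "'p \<Rightarrow> 'b::euclidean_space" and r
  assumes X: "smooth_manifold X" "riemannian_metric X" and f: "isometric_immersion X r f"
begin

lemma immersion_smooth: "smooth_map X f"
  and immersion_sphere: "f ` points X \<subseteq> sphere 0 r"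
  using f by (auto simp: isometric_immersion_def)

lemma immersion_metric:
  "c \<in> atlas X \<Longrightarrow> p \<in> domain c \<Longrightarrow> metric X c p $ i $ j = pd c i f p \<bullet> pd c j f p"
  using f by (auto simp: isometric_immersion_def)

context
  fixes c p
  assumes c: "c \<in> atlas X" and p: "p \<in> domain c"
begin

lemma pd_metric: "pd c i (\<lambda>q. metric X c q $ j $ l) p =
    pd c j f p \<bullet> pd c i (pd c l f) p + pd c i (pd c j f) p \<bullet> pd c l f p"
proof -
  have "pd c i (\<lambda>q. metric X c q $ j $ l) p = pd c i (\<lambda>q. pd c j f q \<bullet> pd c l f q) p"
    by (rule pd_cong[OF X(1) c p immersion_metric[OF c]])
  also have "\<dots> = pd c j f p \<bullet> pd c i (pd c l f) p + pd c i (pd c j f) p \<bullet> pd c l f p"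
    by (intro pd_inner[OF X(1) c p] pd_diff_in_chart[OF X(1) c immersion_smooth p])
  finally show ?thesis .
qed

text \<open>The six terms that arise from differentiating the metric reduce to two equal ones, as second
  derivatives are symmetric.\<close>

lemma christoffel_immersion: "christoffel X c k i j p =
    (\<Sum>l\<in>UNIV. metric_inv X c p $ k $ l * (pd c i (pd c j f) p \<bullet> pd c l f p))"
proof -
  have "pd c i (\<lambda>q. metric X c q $ j $ l) p + pd c j (\<lambda>q. metric X c q $ i $ l) p
      - pd c l (\<lambda>q. metric X c q $ i $ j) p = 2 * (pd c i (pd c j f) p \<bullet> pd c l f p)" for l
    unfolding pd_metric
    by (simp add: pd_commute[OF X(1) c immersion_smooth p, of j i]
        pd_commute[OF X(1) c immersion_smooth p, of l j]
        pd_commute[OF X(1) c immersion_smooth p, of l i] inner_commute)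
  then show ?thesis
    by (simp add: christoffel_def sum_distrib_left)
qed

text \<open>The Gauss formula for an isometric immersion.\<close>

lemma second_fundamental_form_eq_nabla_d:
  "second_fundamental_form X f c i j p = nabla_d X f c i j p"
proof -
  let ?w = "nabla f c i (pd c j f) p"
  have w: "?w \<bullet> pd c k f p = pd c i (pd c j f) p \<bullet> pd c k f p" for k
    by (simp add: nabla_def tangent_proj_def inner_diff_left
        sphere_inner_pd(1)[OF X(1) c immersion_smooth immersion_sphere p])
  have "trace_in X c p (\<lambda>k l. (?w \<bullet> pd c k f p) *\<^sub>R pd c l f p) =
      (\<Sum>l\<in>UNIV. \<Sum>k\<in>UNIV. metric_inv X c p $ k $ l *\<^sub>R (?w \<bullet> pd c k f p) *\<^sub>R pd c l f p)"
    unfolding trace_in_def by (rule sum.swap)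
  also have "\<dots> = (\<Sum>l\<in>UNIV. christoffel X c l i j p *\<^sub>R pd c l f p)"
    unfolding christoffel_immersion w scaleR_sum_left
    by (intro sum.cong refl) (simp add: metric_inv_sym[OF X(2) c p, of _ l for l])
  finally show ?thesis
    by (simp add: second_fundamental_form_def nabla_d_def Let_def)
qed

end

lemma minimal_imp_tension_zero:
  assumes "p \<in> points X" "mean_curvature X f p = 0"
  shows "tension X f p = 0"
proof -
  have "tr X p (\<lambda>c i j. second_fundamental_form X f c i j p) = 0"
    using assms(2) by (simp add: mean_curvature_def)
  then show ?thesis
    unfolding tension_def tr_def
    by (simp add: second_fundamental_form_eq_nabla_d[OF chart_at[OF X(1) assms(1)]])
qed

end

section \<open>The normal section of the tropical sphere\<close>

text \<open>The unit normal of the tropical sphere in the unit sphere, along \<open>\<psi>\<close>.\<close>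

definition tropical_normal :: "('p \<Rightarrow> 'a::euclidean_space) \<Rightarrow> 'p \<Rightarrow> 'a \<times> real" where
  "tropical_normal \<psi> p = (\<psi> p, - (1 / sqrt 2))"

lemma tropical_normal_eq:
  "tropical_normal \<psi> p = (tropical_inclusion \<circ> \<psi>) p + (0, - sqrt 2)"
  by (simp add: tropical_normal_def tropical_inclusion_def) (simp add: field_simps)

lemma bounded_linear_Pair_0: "bounded_linear (\<lambda>x. (x, 0))"
  by (intro bounded_linear_Pair bounded_linear_ident bounded_linear_zero)

context
  fixes X :: "('p::t2_space, 'm::finite) riem" and \<psi> :: "'p \<Rightarrow> 'a::euclidean_space"
    and \<phi> :: "'p \<Rightarrow> 'a \<times> real"
  assumes X: "smooth_manifold X" "riemannian_metric X"
    and \<psi>: "minimal_isometric_immersion X (1 / sqrt 2) \<psi>"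
    and \<phi>: "\<phi> = tropical_inclusion \<circ> \<psi>"
begin

abbreviation "\<eta> \<equiv> tropical_normal \<psi>"

lemma iso: "isometric_immersion X (1 / sqrt 2) \<psi>"
  using \<psi> by (simp add: minimal_isometric_immersion_def)

lemmas psi_smooth = immersion_smooth[OF X iso]
  and psi_sphere = immersion_sphere[OF X iso]

lemma tropical_smooth: "smooth_map X \<phi>"
  unfolding smooth_map_def smooth_on_def
proof (intro ballI allI)
  fix c k assume c: "c \<in> atlas X"
  from Ck_on_affine[OF open_chart_image[OF X(1) c] bounded_linear_Pair_0 Ck_on_in_chart[OF X(1) c psi_smooth],
      of k "(0, 1 / sqrt 2)"]
  show "Ck_on k (\<phi> \<circ> param c) (chart_image c)"
    by (simp add: \<phi> tropical_inclusion_def o_def)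
qed

lemma psi_inner_self: "p \<in> points X \<Longrightarrow> \<psi> p \<bullet> \<psi> p = 1/2"
  using psi_sphere by (force simp: dot_square_norm power_divide)

lemma tropical_inner_self: "p \<in> points X \<Longrightarrow> \<phi> p \<bullet> \<phi> p = 1"
  by (simp add: \<phi> tropical_inclusion_def psi_inner_self)

lemma tropical_sphere: "\<phi> ` points X \<subseteq> sphere 0 1"
  using tropical_inner_self by (auto simp: norm_eq_1)

lemma normal_inner_tropical: "p \<in> points X \<Longrightarrow> \<eta> p \<bullet> \<phi> p = 0"
  by (simp add: \<phi> tropical_inclusion_def tropical_normal_def psi_inner_self)

lemma normal_inner_self: "p \<in> points X \<Longrightarrow> \<eta> p \<bullet> \<eta> p = 1"
  by (simp add: tropical_normal_def psi_inner_self)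

context
  fixes c p
  assumes c: "c \<in> atlas X" and p: "p \<in> domain c"
begin

lemma in_points: "p \<in> points X"
  using domain_subset_points[OF X(1) c] p by blast

lemma pd_tropical: "pd c i \<phi> p = (pd c i \<psi> p, 0)"
proof -
  have "pd c i \<phi> p = pd c i (\<lambda>q. (\<psi> q, 0) + (0, 1 / sqrt 2)) p"
    by (rule pd_cong[OF X(1) c p]) (simp add: \<phi> tropical_inclusion_def)
  also have "\<dots> = (pd c i \<psi> p, 0)"
    by (rule pd_affine[OF bounded_linear_Pair_0 smooth_map_diff_in_chart[OF X(1) c psi_smooth p]])
  finally show ?thesis .
qed

lemma pd_tropical_inner: "pd c i \<phi> p \<bullet> pd c j \<phi> p = metric X c p $ i $ j"
  by (simp add: pd_tropical immersion_metric[OF X iso c p])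

lemma normal_inner_pd: "\<eta> p \<bullet> pd c i \<phi> p = 0"
  by (simp add: pd_tropical tropical_normal_def sphere_inner_pd(1)[OF X(1) c psi_smooth psi_sphere p])

end

lemma pd_pd_tropical:
  assumes c: "c \<in> atlas X" and p: "p \<in> domain c"
  shows "pd c i (pd c j \<phi>) p = (pd c i (pd c j \<psi>) p, 0)"
proof -
  have "pd c i (pd c j \<phi>) p = pd c i (\<lambda>q. (pd c j \<psi> q, 0) + 0) p"
    by (rule pd_cong[OF X(1) c p]) (simp add: pd_tropical[OF c])
  also have "\<dots> = (pd c i (pd c j \<psi>) p, 0)"
    by (rule pd_affine[OF bounded_linear_Pair_0 pd_diff_in_chart[OF X(1) c psi_smooth p]])
  finally show ?thesis .
qed

text \<open>The tropical sphere is umbilical in the unit sphere: its second fundamental form is the metric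
  times \<open>- \<eta>\<close>.\<close>

lemma nabla_d_tropical:
  assumes c: "c \<in> atlas X" and p: "p \<in> domain c"
  shows "nabla_d X \<phi> c i j p = (nabla_d X \<psi> c i j p, 0) + - (metric X c p $ i $ j *\<^sub>R \<eta> p)"
proof -
  let ?g = "metric X c p $ i $ j" and ?h = "pd c i (pd c j \<psi>) p"
  have inner: "?h \<bullet> \<psi> p = - ?g"
    using sphere_inner_pd_pd[OF X(1) c psi_smooth psi_sphere p] immersion_metric[OF X iso c p] by simp
  have "nabla \<phi> c i (pd c j \<phi>) p = (?h, 0) + ?g *\<^sub>R \<phi> p"
    using tropical_inner_self[OF in_points[OF c p]] inner
    by (simp add: nabla_def tangent_proj_def pd_pd_tropical[OF c p])
      (simp add: \<phi> tropical_inclusion_def)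
  moreover have "nabla \<psi> c i (pd c j \<psi>) p = ?h + (2 * ?g) *\<^sub>R \<psi> p"
    by (simp add: nabla_def tangent_proj_def psi_inner_self[OF in_points[OF c p]] inner)
  moreover have "(\<Sum>k\<in>UNIV. christoffel X c k i j p *\<^sub>R pd c k \<phi> p) =
      (\<Sum>k\<in>UNIV. christoffel X c k i j p *\<^sub>R pd c k \<psi> p, 0)"
    by (simp add: pd_tropical[OF c p] sum_prod)
  ultimately show ?thesis
    by (simp add: nabla_d_def \<phi> tropical_inclusion_def tropical_normal_def)
      (simp flip: scaleR_diff_left)
qed

lemma tension_tropical:
  assumes p: "p \<in> points X"
  shows "tension X \<phi> p = (- real CARD('m)) *\<^sub>R \<eta> p"
proof -
  let ?c = "chart_at X p"
  note c = chart_at[OF X(1) p]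
  have "tension X \<psi> p = 0"
    using minimal_imp_tension_zero[OF X iso p] \<psi> p by (simp add: minimal_isometric_immersion_def)
  then have "trace_in X ?c p (\<lambda>i j. (nabla_d X \<psi> ?c i j p, 0::real)) = 0"
    unfolding trace_in_linear[OF bounded_linear.linear[OF bounded_linear_Pair_0]]
    by (simp add: tension_def tr_def zero_prod_def)
  moreover have "trace_in X ?c p (\<lambda>i j. - (metric X ?c p $ i $ j *\<^sub>R \<eta> p)) = - (real CARD('m) *\<^sub>R \<eta> p)"
    using trace_in_linear[of "\<lambda>r. - (r *\<^sub>R \<eta> p)" X ?c p "\<lambda>i j. metric X ?c p $ i $ j"]
      trace_metric[OF X(2) c]
    by (simp add: linear_iff scaleR_left_distrib)
  ultimately show ?thesis
    unfolding tension_def tr_def nabla_d_tropical[OF c] trace_in_add by simp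
qed

lemma energy_density_tropical: "p \<in> points X \<Longrightarrow> energy_density X \<phi> p = real CARD('m)"
  by (simp add: energy_density_def tr_def pd_tropical_inner[OF chart_at[OF X(1)]]
      trace_metric[OF X(2) chart_at[OF X(1)]])

context
  \<comment> \<open>Nothing is assumed off the manifold, so that \<open>V\<close> may be any of the sections that occur in the
    second variation operator.\<close>
  fixes V a
  assumes V: "\<And>q. q \<in> points X \<Longrightarrow> V q = a *\<^sub>R \<eta> q"
begin

lemma nabla_normal:
  assumes c: "c \<in> atlas X" and p: "p \<in> domain c"
  shows "nabla \<phi> c i V p = a *\<^sub>R pd c i \<phi> p"
proof -
  have "pd c i V p = pd c i (\<lambda>q. a *\<^sub>R \<phi> q + a *\<^sub>R (0, - sqrt 2)) p"
    by (rule pd_cong[OF X(1) c p])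
      (simp only: V[OF in_points[OF c]] tropical_normal_eq \<phi> scaleR_add_right)
  also have "\<dots> = a *\<^sub>R pd c i \<phi> p"
    by (rule pd_affine[OF bounded_linear_scaleR_right smooth_map_diff_in_chart[OF X(1) c tropical_smooth p]])
  finally show ?thesis
    by (simp add: nabla_def tangent_proj_def sphere_inner_pd(2)[OF X(1) c tropical_smooth tropical_sphere p])
qed

lemma laplacian_normal:
  assumes p: "p \<in> points X"
  shows "laplacian X \<phi> V p = (real CARD('m) * a) *\<^sub>R \<eta> p"
proof -
  let ?c = "chart_at X p"
  note c = chart_at[OF X(1) p]
  have "nabla \<phi> ?c i (nabla \<phi> ?c j V) p = a *\<^sub>R nabla \<phi> ?c i (pd ?c j \<phi>) p" for i j
  proof -
    have "pd ?c i (nabla \<phi> ?c j V) p = pd ?c i (\<lambda>q. a *\<^sub>R pd ?c j \<phi> q) p"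
      by (rule pd_cong[OF X(1) c nabla_normal[OF c(1)]])
    also have "\<dots> = a *\<^sub>R pd ?c i (pd ?c j \<phi>) p"
      by (rule pd_scaleR[OF pd_diff_in_chart[OF X(1) c(1) tropical_smooth c(2)]])
    finally show ?thesis
      by (simp add: nabla_def tangent_proj_def scaleR_diff_right)
  qed
  then have "nabla \<phi> ?c i (nabla \<phi> ?c j V) p - (\<Sum>k\<in>UNIV. christoffel X ?c k i j p *\<^sub>R nabla \<phi> ?c k V p) =
      a *\<^sub>R nabla_d X \<phi> ?c i j p" for i j
    by (simp add: nabla_d_def nabla_normal[OF c] scaleR_diff_right scaleR_sum_right mult.commute)
  then have "laplacian X \<phi> V p = - (a *\<^sub>R tension X \<phi> p)"
    unfolding laplacian_def tension_def tr_def
    using trace_in_linear[of "(*\<^sub>R) a" X ?c p "\<lambda>i j. nabla_d X \<phi> ?c i j p"] by (simp add: linear_iff scaleR_add_right)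
  then show ?thesis
    by (simp add: tension_tropical[OF p] mult.commute)
qed

lemma tr_d_normal: "p \<in> points X \<Longrightarrow> tr_d X \<phi> V p = 0"
  by (simp add: tr_d_def tr_def trace_in_def V normal_inner_pd[OF chart_at[OF X(1)]])

lemma nabla_inner_d_normal:
  assumes p: "p \<in> points X"
  shows "nabla_inner_d X \<phi> V p = real CARD('m) * a"
proof -
  have "nabla_inner_d X \<phi> V p = trace_in X (chart_at X p) p (\<lambda>i j. a * metric X (chart_at X p) p $ i $ j)"
    by (simp add: nabla_inner_d_def tr_def nabla_normal[OF chart_at[OF X(1) p]]
        pd_tropical_inner[OF chart_at[OF X(1) p]])
  also have "\<dots> = a * real CARD('m)"
    using trace_in_linear[of "(*) a" X "chart_at X p" p "\<lambda>i j. metric X (chart_at X p) p $ i $ j"]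
      trace_metric[OF X(2) chart_at[OF X(1) p]] by (simp add: linear_iff distrib_left)
  finally show ?thesis by simp
qed

lemma tr_nabla_d_normal:
  assumes "p \<in> points X" "W p = b *\<^sub>R \<eta> p"
  shows "tr_nabla_d X \<phi> W V p = 0"
  by (simp add: tr_nabla_d_def tr_def trace_in_def assms(2) nabla_normal[OF chart_at[OF X(1) assms(1)]]
      normal_inner_pd[OF chart_at[OF X(1) assms(1)]])

end

text \<open>The operator acts on the normal section as multiplication by \<open>-4 m\<^sup>2\<close>.\<close>

lemma second_variation_normal:
  assumes V: "\<And>q. q \<in> points X \<Longrightarrow> V q = a *\<^sub>R \<eta> q" and p: "p \<in> points X"
  shows "second_variation X \<phi> V p = (- 4 * (real CARD('m))\<^sup>2 * a) *\<^sub>R \<eta> p"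
proof -
  let ?N = "real CARD('m)"
  note tension_tropical[simp] energy_density_tropical[simp]
  have LV: "laplacian X \<phi> V q = (?N * a) *\<^sub>R \<eta> q" if "q \<in> points X" for q
    by (rule laplacian_normal[OF V that])
  have "laplacian X \<phi> (laplacian X \<phi> V) p = (?N * (?N * a)) *\<^sub>R \<eta> p"
    by (rule laplacian_normal[OF LV p])
  moreover have "laplacian X \<phi> (\<lambda>q. tr_d X \<phi> V q - energy_density X \<phi> q *\<^sub>R V q) p = (?N * (- ?N * a)) *\<^sub>R \<eta> p"
    by (rule laplacian_normal[OF _ p]) (simp add: tr_d_normal[OF V] V)
  moreover have "nabla_inner_d X \<phi> (tension X \<phi>) p = ?N * (- ?N)"
    by (rule nabla_inner_d_normal[OF tension_tropical p])
  moreover have "tr_nabla_d X \<phi> V (tension X \<phi>) p = 0"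
    by (rule tr_nabla_d_normal[where W = V and b = a, OF tension_tropical p V[OF p]])
  moreover have "tr_nabla_d X \<phi> (tension X \<phi>) V p = 0"
    by (rule tr_nabla_d_normal[where W = "tension X \<phi>" and b = "- ?N", OF V p tension_tropical[OF p]])
  moreover have "tr_d X \<phi> (laplacian X \<phi> V) p = 0"
    by (rule tr_d_normal[OF LV p])
  moreover have "tr_d X \<phi> V q = 0" if "q \<in> points X" for q
    by (rule tr_d_normal[OF V that])
  moreover have "tr_d X \<phi> (tr_d X \<phi> V) p = 0"
    by (rule tr_d_normal[where a=0, OF _ p]) (simp add: tr_d_normal[OF V])
  moreover have "nabla_inner_d X \<phi> V p = ?N * a"
    by (rule nabla_inner_d_normal[OF V p])
  moreover have "(norm (tension X \<phi> p))\<^sup>2 = ?N\<^sup>2" "tension X \<phi> p \<bullet> V p = - ?N * a"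
    using normal_inner_self[OF p] norm_eq_1[of "\<eta> p"] by (simp_all add: p V power_mult_distrib)
  ultimately have "second_variation X \<phi> V p =
     (?N * (?N * a)) *\<^sub>R \<eta> p + (?N * (- ?N * a)) *\<^sub>R \<eta> p + (2 * (?N * (- ?N))) *\<^sub>R (a *\<^sub>R \<eta> p)
     + ?N\<^sup>2 *\<^sub>R (a *\<^sub>R \<eta> p) - (- ?N * a) *\<^sub>R ((- ?N) *\<^sub>R \<eta> p) + (2 * (?N * a)) *\<^sub>R ((- ?N) *\<^sub>R \<eta> p)
     - ?N *\<^sub>R ((?N * a) *\<^sub>R \<eta> p) + ?N\<^sup>2 *\<^sub>R (a *\<^sub>R \<eta> p)"
    unfolding second_variation_def Let_def
    by (simp only: LV[OF p] V[OF p] p tension_tropical energy_density_tropical scaleR_zero_right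
        add_0_right diff_0_right)
  also have "\<dots> = (?N * (?N * a) + ?N * (- ?N * a) + (2 * (?N * (- ?N))) * a + ?N\<^sup>2 * a
      - (- ?N * a) * (- ?N) + (2 * (?N * a)) * (- ?N) - ?N * (?N * a) + ?N\<^sup>2 * a) *\<^sub>R \<eta> p"
    by (simp only: scaleR_add_left scaleR_diff_left scaleR_scaleR)
  also have "?N * (?N * a) + ?N * (- ?N * a) + (2 * (?N * (- ?N))) * a + ?N\<^sup>2 * a
      - (- ?N * a) * (- ?N) + (2 * (?N * a)) * (- ?N) - ?N * (?N * a) + ?N\<^sup>2 * a = - 4 * ?N\<^sup>2 * a"
    by (simp add: power2_eq_square)
  finally show ?thesis .
qed

end

section \<open>The Riemannian measure is finite and nonzero\<close>

lemma compact_chart_cover_exists: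
  fixes X :: "('p::t2_space, 'm::finite) riem"
  assumes X: "smooth_manifold X" and comp: "compact (points X)"
  shows "\<exists>cs. compact_chart_cover X cs"
proof -
  have "\<exists>c K U. c \<in> atlas X \<and> compact K \<and> K \<subseteq> domain c \<and> openin (top_of_set (points X)) U \<and> p \<in> U \<and> U \<subseteq> K"
    if "p \<in> points X" for p
  proof -
    obtain c where c: "c \<in> atlas X" and p: "p \<in> domain c"
      using chart_at[OF X \<open>p \<in> points X\<close>] by blast
    obtain e where e: "e > 0" "cball (coord c p) e \<subseteq> chart_image c"
      using open_contains_cball open_chart_image[OF X c] coord_in_chart_image[OF X c p] by blast
    have hom: "homeomorphism (chart_image c) (domain c) (param c) (coord c)"
      using chart_homeomorphism[OF X c] by (rule homeomorphism_symD)
    then have "continuous_on (chart_image c) (param c)"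
      by (simp add: homeomorphism_def)
    then have "compact (param c ` cball (coord c p) e)"
      using e(2) by (intro compact_continuous_image) (auto intro: continuous_on_subset)
    moreover have "openin (top_of_set (domain c)) (param c ` ball (coord c p) e)"
      by (rule homeomorphism_imp_open_map[OF hom])
        (use e(2) ball_subset_cball in \<open>auto intro!: open_openin_trans open_chart_image[OF X c]\<close>)
    then have "openin (top_of_set (points X)) (param c ` ball (coord c p) e)"
      using openin_domain[OF X c] openin_trans by blast
    moreover have "p \<in> param c ` ball (coord c p) e"
      using e(1) param_coord[OF X c p] by (metis centre_in_ball imageI)
    moreover have "param c ` ball (coord c p) e \<subseteq> param c ` cball (coord c p) e"
      by (intro image_mono ball_subset_cball)
    moreover have "param c ` cball (coord c p) e \<subseteq> domain c"
      using e(2) param_in_domain[OF X c] by blast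
    ultimately show ?thesis using c by blast
  qed
  then obtain C K U where C: "\<And>p. p \<in> points X \<Longrightarrow> C p \<in> atlas X \<and> compact (K p) \<and> K p \<subseteq> domain (C p) \<and>
      openin (top_of_set (points X)) (U p) \<and> p \<in> U p \<and> U p \<subseteq> K p"
    by metis
  have "\<exists>D\<subseteq>U ` points X. finite D \<and> points X \<subseteq> \<Union>D"
    by (rule comp[unfolded compact_eq_openin_cover, rule_format]) (use C in blast)
  then obtain F where F: "F \<subseteq> points X" "finite F" "points X \<subseteq> \<Union>(U ` F)"
    by (metis finite_subset_image)
  then obtain ps where ps: "set ps = F" using finite_list by blast
  have "(\<Union>p\<in>F. K p) = points X"
  proof
    have "K p \<subseteq> points X" if "p \<in> F" for p
      using C[of p] domain_subset_points[OF X, of "C p"] that F(1) by blast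
    then show "(\<Union>p\<in>F. K p) \<subseteq> points X" by blast
    have "U p \<subseteq> K p" if "p \<in> F" for p
      using C[of p] that F(1) by blast
    then show "points X \<subseteq> (\<Union>p\<in>F. K p)" using F(3) by blast
  qed
  then have "compact_chart_cover X (map (\<lambda>p. (C p, K p)) ps)"
    unfolding compact_chart_cover_def using C F(1) ps by auto
  then show ?thesis ..
qed

context
  fixes X :: "('p::t2_space, 'm::finite) riem"
  assumes X: "smooth_manifold X" "riemannian_metric X" "compact (points X)"
begin

text \<open>The density of the Riemannian measure in the coordinates of the chart \<open>c\<close>.\<close>

abbreviation "vol_density c u \<equiv> sqrt (det (metric X c (param c u)))"

lemma continuous_density:
  assumes c: "c \<in> atlas X"
  shows "continuous_on (chart_image c) (vol_density c)"
proof -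
  have "smooth_on (metric X c \<circ> param c) (chart_image c)"
    using X(2) c by (auto simp: riemannian_metric_def)
  then have "Ck_on 0 (metric X c \<circ> param c) (chart_image c)"
    unfolding smooth_on_def by blast
  then have "continuous_on (chart_image c) (\<lambda>u. metric X c (param c u))"
    by (simp add: o_def)
  then show ?thesis
    unfolding det_def by (intro continuous_intros)
qed

lemma density_pos:
  assumes c: "c \<in> atlas X" and u: "u \<in> chart_image c"
  shows "vol_density c u > 0"
  using det_pos_def[OF metric_pos_def[OF X(2) c param_in_domain[OF X(1) c u]]] by simp

lemma coord_image_eq:
  assumes c: "c \<in> atlas X" and "D \<subseteq> domain c"
  shows "coord c ` D = {u \<in> chart_image c. param c u \<in> D}"
  using assms param_coord[OF X(1) c] coord_param[OF X(1) c] coord_in_chart_image[OF X(1) c]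
  by (auto simp: image_iff) (metis subsetD)

lemma param_measurable:
  assumes c: "c \<in> atlas X"
  shows "param c \<in> restrict_space lborel (chart_image c) \<rightarrow>\<^sub>M restrict_space borel (points X)"
proof (rule measurable_restrict_space2)
  show "param c \<in> space (restrict_space lborel (chart_image c)) \<rightarrow> points X"
    using param_in_domain[OF X(1) c] domain_subset_points[OF X(1) c] by (auto simp: space_restrict_space)
  have "continuous_on (chart_image c) (param c)"
    using chart_homeomorphism[OF X(1) c] by (simp add: homeomorphism_def)
  from borel_measurable_continuous_on_restrict[OF this]
  show "param c \<in> restrict_space lborel (chart_image c) \<rightarrow>\<^sub>M borel"
    by (simp add: measurable_def sets_restrict_space space_restrict_space)
qed

lemma coord_image_borel:
  assumes c: "c \<in> atlas X" and A: "A \<in> sets borel" "A \<subseteq> domain c"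
  shows "coord c ` A \<in> sets borel"
proof -
  have "A \<in> sets (restrict_space borel (points X))"
    using A domain_subset_points[OF X(1) c] by (auto simp: sets_restrict_space)
  from measurable_sets[OF param_measurable[OF c] this]
  have "param c -` A \<inter> chart_image c \<in> sets (restrict_space lborel (chart_image c))"
    by (simp add: space_restrict_space)
  then have "param c -` A \<inter> chart_image c \<in> sets borel"
    using open_chart_image[OF X(1) c] by (auto simp: sets_restrict_space)
  also have "param c -` A \<inter> chart_image c = coord c ` A"
    using coord_image_eq[OF c A(2)] by auto
  finally show ?thesis .
qed

lemma density_indicator_measurable:
  assumes c: "c \<in> atlas X" and S: "S \<in> sets borel" "S \<subseteq> chart_image c"
  shows "(\<lambda>u. ennreal (vol_density c u) * indicator S u) \<in> borel_measurable lborel"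
proof -
  have "(\<lambda>u. ennreal (indicator S u *\<^sub>R vol_density c u)) \<in> borel_measurable borel"
    by (intro measurable_compose[OF _ measurable_ennreal] borel_measurable_continuous_on_indicator S
        continuous_on_subset[OF continuous_density[OF c]])
  moreover have "(\<lambda>u. ennreal (indicator S u *\<^sub>R vol_density c u)) = (\<lambda>u. ennreal (vol_density c u) * indicator S u)"
    by (auto split: split_indicator)
  ultimately show ?thesis by simp
qed

text \<open>The Riemannian measure of \<open>A \<inter> D\<close>, computed in the chart \<open>c\<close>, whose domain is to contain
  \<open>D\<close>.\<close>

definition piece_measure :: "('p, 'm) chart \<Rightarrow> 'p set \<Rightarrow> 'p set \<Rightarrow> ennreal" where
  "piece_measure c D A = (\<integral>\<^sup>+ u \<in> coord c ` (A \<inter> D). ennreal (vol_density c u) \<partial>lborel)"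

lemma piece_measure_countably_additive:
  assumes c: "c \<in> atlas X" and D: "D \<in> sets borel" "D \<subseteq> domain c"
    and A: "range A \<subseteq> sets borel" "disjoint_family A"
  shows "(\<Sum>i. piece_measure c D (A i)) = piece_measure c D (\<Union>i. A i)"
proof -
  have inj: "inj_on (coord c) D"
    using D(2) param_coord[OF X(1) c] by (metis inj_on_inverseI subsetD)
  have dis: "disjoint_family (\<lambda>i. coord c ` (A i \<inter> D))"
    unfolding disjoint_family_on_def
  proof (intro ballI impI)
    fix i j :: nat assume "i \<noteq> j"
    then have "A i \<inter> A j = {}" using A(2) by (auto simp: disjoint_family_on_def)
    then show "coord c ` (A i \<inter> D) \<inter> coord c ` (A j \<inter> D) = {}"
      using inj_on_image_Int[OF inj, of "A i \<inter> D" "A j \<inter> D"] by auto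
  qed
  have sub: "coord c ` (A i \<inter> D) \<subseteq> chart_image c" for i
    using D(2) coord_in_chart_image[OF X(1) c] by auto
  have "(\<Sum>i. piece_measure c D (A i)) =
      (\<integral>\<^sup>+ u. (\<Sum>i. ennreal (vol_density c u) * indicator (coord c ` (A i \<inter> D)) u) \<partial>lborel)"
    unfolding piece_measure_def
    by (intro nn_integral_suminf[symmetric] density_indicator_measurable[OF c _ sub] coord_image_borel[OF c])
      (use A(1) D in auto)
  also have "\<dots> = (\<integral>\<^sup>+ u \<in> (\<Union>i. coord c ` (A i \<inter> D)). ennreal (vol_density c u) \<partial>lborel)"
    by (simp add: suminf_indicator[OF dis])
  also have "(\<Union>i. coord c ` (A i \<inter> D)) = coord c ` ((\<Union>i. A i) \<inter> D)"
    by auto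
  finally show ?thesis unfolding piece_measure_def .
qed

lemma piece_measure_finite:
  assumes c: "c \<in> atlas X" and D: "D \<subseteq> K" "compact K" "K \<subseteq> domain c"
  shows "piece_measure c D A < \<infinity>"
proof -
  have "continuous_on K (coord c)"
    using chart_homeomorphism[OF X(1) c] D(3) by (auto simp: homeomorphism_def intro: continuous_on_subset)
  then have cK: "compact (coord c ` K)"
    using D(2) compact_continuous_image by blast
  have sub: "coord c ` K \<subseteq> chart_image c"
    using D(3) coord_in_chart_image[OF X(1) c] by auto
  have "bounded (vol_density c ` coord c ` K)"
    by (intro compact_imp_bounded compact_continuous_image cK continuous_on_subset[OF continuous_density[OF c] sub])
  then obtain B where B: "\<And>u. u \<in> coord c ` K \<Longrightarrow> \<bar>vol_density c u\<bar> \<le> B"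
    unfolding bounded_iff by auto
  have "piece_measure c D A \<le> (\<integral>\<^sup>+ u. ennreal B * indicator (coord c ` K) u \<partial>lborel)"
    unfolding piece_measure_def
  proof (rule nn_integral_mono)
    fix u
    show "ennreal (vol_density c u) * indicator (coord c ` (A \<inter> D)) u \<le> ennreal B * indicator (coord c ` K) u"
    proof (cases "u \<in> coord c ` (A \<inter> D)")
      case True
      then have "u \<in> coord c ` K" using D(1) by auto
      then show ?thesis using True B[of u] by (auto intro: ennreal_leI)
    qed simp
  qed
  also have "\<dots> = ennreal B * emeasure lborel (coord c ` K)"
    by (simp add: nn_integral_cmult_indicator borel_compact[OF cK])
  also have "\<dots> < \<infinity>"
    using emeasure_compact_finite[OF cK] by (simp add: ennreal_mult_less_top)
  finally show ?thesis .
qed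

lemma piece_measure_zero:
  assumes c: "c \<in> atlas X" and D: "D \<in> sets borel" "D \<subseteq> domain c" and z: "piece_measure c D (points X) = 0"
  shows "negligible (coord c ` D)"
proof -
  let ?S = "coord c ` D"
  have S: "?S \<in> sets borel" "?S \<subseteq> chart_image c"
    using coord_image_borel[OF c D] D(2) coord_in_chart_image[OF X(1) c] by auto
  have "points X \<inter> D = D"
    using D(2) domain_subset_points[OF X(1) c] by auto
  then have "(\<integral>\<^sup>+ u. ennreal (vol_density c u) * indicator ?S u \<partial>lborel) = 0"
    using z by (simp add: piece_measure_def)
  then have "AE u in lborel. ennreal (vol_density c u) * indicator ?S u = 0"
    by (subst (asm) nn_integral_0_iff_AE[OF density_indicator_measurable[OF c S]])
  then have "AE u in lborel. u \<notin> ?S"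
  proof (rule AE_mp, intro AE_I2 impI notI)
    fix u assume u: "ennreal (vol_density c u) * indicator ?S u = 0" "u \<in> ?S"
    then have "vol_density c u > 0" using density_pos[OF c] S(2) by blast
    then show False using u by simp
  qed
  then have "?S \<in> null_sets lborel"
    using AE_iff_null_sets S(1) by (metis sets_lborel)
  then show ?thesis
    using negligible_iff_null_sets null_sets_completionI by blast
qed

text \<open>Being a null set does not depend on the chart.\<close>

lemma transition_negligible:
  assumes c: "c \<in> atlas X" and d: "d \<in> atlas X" and D: "D \<subseteq> domain c" "negligible (coord c ` D)"
  shows "negligible (coord d ` (D \<inter> domain d))"
proof -
  let ?S = "coord c ` (D \<inter> domain d)"
  have "smooth_on (coord d \<circ> param c) (coord c ` (domain c \<inter> domain d))"
    using X(1) c d unfolding smooth_manifold_def by blast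
  then have "Ck_on (Suc 0) (coord d \<circ> param c) (coord c ` (domain c \<inter> domain d))"
    unfolding smooth_on_def by blast
  moreover have "?S \<subseteq> coord c ` (domain c \<inter> domain d)"
    using D(1) by blast
  ultimately have "(coord d \<circ> param c) differentiable (at u)" if "u \<in> ?S" for u
    using that Ck_on_differentiable by blast
  then have "(coord d \<circ> param c) differentiable_on ?S"
    unfolding differentiable_on_def by (blast intro: differentiable_at_withinI)
  moreover have "negligible ?S"
    by (rule negligible_subset[OF D(2)]) auto
  ultimately have "negligible ((coord d \<circ> param c) ` ?S)"
    by (rule negligible_differentiable_image_negligible[OF order_refl, rotated])
  moreover have "(coord d \<circ> param c) ` ?S = coord d ` (D \<inter> domain d)"
    unfolding image_image comp_apply
    by (rule image_cong[OF refl]) (use D(1) param_coord[OF X(1) c] in auto)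
  ultimately show ?thesis by simp
qed

context
  fixes cs :: "(('p, 'm) chart \<times> 'p set) list"
  assumes cs: "compact_chart_cover X cs"
begin

text \<open>The \<open>k\<close>-th chart, the compact set chosen in it, and the part of that set that no earlier one
  covers.\<close>

abbreviation "C k \<equiv> fst (cs ! k)"
abbreviation "K k \<equiv> snd (cs ! k)"
abbreviation "D k \<equiv> K k - (\<Union>j<k. K j)"

lemma cover_nth:
  assumes "k < length cs"
  shows "C k \<in> atlas X" "compact (K k)" "K k \<subseteq> domain (C k)"
proof -
  have "(C k, K k) \<in> set cs" using assms by simp
  then show "C k \<in> atlas X" "compact (K k)" "K k \<subseteq> domain (C k)"
    using cs unfolding compact_chart_cover_def by fast+
qed

lemma pieces_borel: "k < length cs \<Longrightarrow> D k \<in> sets borel"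
  by (intro sets.Diff sets.finite_UN borel_compact cover_nth(2)) auto

lemma pieces_cover: "points X \<subseteq> (\<Union>k<length cs. D k)"
proof
  fix p assume "p \<in> points X"
  then have "p \<in> (\<Union>(c, K) \<in> set cs. K)"
    using cs unfolding compact_chart_cover_def by blast
  then obtain x where "x \<in> set cs" "p \<in> snd x"
    by auto
  then obtain k where k: "k < length cs" "p \<in> K k"
    by (auto simp: in_set_conv_nth)
  define n where "n = (LEAST k. k < length cs \<and> p \<in> K k)"
  have n: "n < length cs \<and> p \<in> K n"
    unfolding n_def by (rule LeastI[of _ k]) (use k in auto)
  moreover have "p \<notin> K j" if "j < n" for j
    using not_less_Least[of j "\<lambda>k. k < length cs \<and> p \<in> K k"] that n by (auto simp: n_def)
  ultimately show "p \<in> (\<Union>k<length cs. D k)" by blast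
qed

lemma cover_measure_eq: "cover_measure X cs A = (\<Sum>k<length cs. piece_measure (C k) (D k) A)"
  by (simp add: cover_measure_def piece_measure_def Let_def)

lemma cover_measure_finite: "cover_measure X cs A < \<infinity>"
  unfolding cover_measure_eq using piece_measure_finite[OF cover_nth(1) _ cover_nth(2,3)]
  by (auto simp: less_top)

lemma cover_measure_nonzero:
  assumes "points X \<noteq> {}"
  shows "cover_measure X cs (points X) \<noteq> 0"
proof
  assume 0: "cover_measure X cs (points X) = 0"
  obtain p d where d: "d \<in> atlas X" "p \<in> domain d"
    using assms chart_at[OF X(1)] by blast
  have "negligible (coord d ` (D k \<inter> domain d))" if k: "k < length cs" for k
  proof (rule transition_negligible[OF cover_nth(1)[OF k] d(1)])
    show "D k \<subseteq> domain (C k)" using cover_nth(3)[OF k] by auto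
    then show "negligible (coord (C k) ` D k)"
      using 0 k by (intro piece_measure_zero[OF cover_nth(1)[OF k] pieces_borel[OF k]])
        (auto simp: cover_measure_eq)
  qed
  then have "negligible (\<Union>k<length cs. coord d ` (D k \<inter> domain d))"
    by (auto intro!: negligible_Union)
  moreover have "domain d = (\<Union>k<length cs. D k \<inter> domain d)"
    using pieces_cover domain_subset_points[OF X(1) d(1)] by auto
  then have "chart_image d = (\<Union>k<length cs. coord d ` (D k \<inter> domain d))"
    unfolding chart_image_def image_UN[symmetric] by (rule arg_cong)
  ultimately have "negligible (chart_image d)"
    by simp
  then show False
    using open_not_negligible open_chart_image[OF X(1) d(1)] coord_in_chart_image[OF X(1) d] by blast
qed

lemma cover_measure_countably_additive:
  "countably_additive (sets (restrict_space borel (points X))) (cover_measure X cs)"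
  unfolding countably_additive_def
proof (intro allI impI)
  fix A :: "nat \<Rightarrow> 'p set"
  assume A: "range A \<subseteq> sets (restrict_space borel (points X))" "disjoint_family A"
  have "points X \<in> sets borel" using X(3) borel_compact by blast
  then have "range A \<subseteq> sets borel" using A(1) by (auto simp: sets_restrict_space)
  then have "(\<Sum>i. piece_measure (C k) (D k) (A i)) = piece_measure (C k) (D k) (\<Union>i. A i)"
    if "k < length cs" for k
    using cover_nth(3)[OF that]
    by (intro piece_measure_countably_additive[OF cover_nth(1)[OF that] pieces_borel[OF that] _ _ A(2)]) auto
  then show "(\<Sum>i. cover_measure X cs (A i)) = cover_measure X cs (\<Union>i. A i)"
    unfolding cover_measure_eq by (subst suminf_sum) auto
qed

end

lemma
  shows space_volume: "space (volume X) = points X"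
    and volume_finite: "emeasure (volume X) (points X) < \<infinity>"
    and volume_nonzero: "points X \<noteq> {} \<Longrightarrow> emeasure (volume X) (points X) \<noteq> 0"
proof -
  let ?R = "restrict_space borel (points X) :: 'p measure"
  define cs where "cs = (SOME cs. compact_chart_cover X cs)"
  have cs: "compact_chart_cover X cs"
    unfolding cs_def by (rule someI_ex[OF compact_chart_cover_exists[OF X(1,3)]])
  have R: "space ?R = points X" "sets ?R \<subseteq> Pow (points X)"
    by (auto simp: space_restrict_space sets_restrict_space)
  then show "space (volume X) = points X"
    by (simp add: volume_def space_measure_of)
  have "emeasure (volume X) (points X) = cover_measure X cs (points X)"
    unfolding volume_def cs_def[symmetric]
  proof (rule emeasure_measure_of_sigma)
    show "sigma_algebra (points X) (sets ?R)"
      using sets.sigma_algebra_axioms[of ?R] R(1) by simp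
    show "positive (sets ?R) (cover_measure X cs)"
      by (simp add: positive_def cover_measure_eq[OF cs] piece_measure_def)
    show "points X \<in> sets ?R"
      using sets.top[of ?R] R(1) by simp
  qed (rule cover_measure_countably_additive[OF cs])
  then show "emeasure (volume X) (points X) < \<infinity>"
    and "points X \<noteq> {} \<Longrightarrow> emeasure (volume X) (points X) \<noteq> 0"
    using cover_measure_finite[OF cs] cover_measure_nonzero[OF cs] by simp_all
qed

end

section \<open>Instability\<close>

text \<open>The unit normal, made to vanish off the manifold as sections are required to.\<close>

definition normal_section :: "('p, 'm::finite) riem \<Rightarrow> ('p \<Rightarrow> 'a::euclidean_space) \<Rightarrow> 'p \<Rightarrow> 'a \<times> real" where
  "normal_section X \<psi> p = (if p \<in> points X then tropical_normal \<psi> p else 0)"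

context
  fixes X :: "('p::t2_space, 'm::finite) riem" and \<psi> :: "'p \<Rightarrow> 'a::euclidean_space"
    and \<phi> :: "'p \<Rightarrow> 'a \<times> real"
  assumes X: "smooth_manifold X" "riemannian_metric X"
    and \<psi>: "minimal_isometric_immersion X (1 / sqrt 2) \<psi>"
    and \<phi>: "\<phi> = tropical_inclusion \<circ> \<psi>"
begin

lemma scale_normal_section:
  "p \<in> points X \<Longrightarrow> scale_fun a (normal_section X \<psi>) p = a *\<^sub>R tropical_normal \<psi> p"
  by (simp add: scale_fun_def normal_section_def)

lemma smooth_section_normal: "smooth_section X \<phi> (scale_fun a (normal_section X \<psi>))"
  unfolding smooth_section_def smooth_map_def smooth_on_def
proof (intro conjI ballI allI impI)
  fix c k assume c: "c \<in> atlas X"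
  have "Ck_on k (\<lambda>u. a *\<^sub>R (\<phi> \<circ> param c) u + a *\<^sub>R (0, - sqrt 2)) (chart_image c)"
    by (rule Ck_on_affine[OF open_chart_image[OF X(1) c] bounded_linear_scaleR_right
          Ck_on_in_chart[OF X(1) c tropical_smooth[OF X \<psi> \<phi>]]])
  then show "Ck_on k (scale_fun a (normal_section X \<psi>) \<circ> param c) (chart_image c)"
  proof (rule Ck_on_cong[OF open_chart_image[OF X(1) c], rotated])
    fix u assume "u \<in> chart_image c"
    then have "param c u \<in> points X"
      using param_in_domain[OF X(1) c] domain_subset_points[OF X(1) c] by blast
    then show "a *\<^sub>R (\<phi> \<circ> param c) u + a *\<^sub>R (0, - sqrt 2) = (scale_fun a (normal_section X \<psi>) \<circ> param c) u"
      unfolding comp_apply scale_normal_section[OF \<open>param c u \<in> points X\<close>] tropical_normal_eq \<phi>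
      by (simp only: scaleR_add_right comp_apply)
  qed
next
  fix p assume "p \<in> points X"
  then show "scale_fun a (normal_section X \<psi>) p \<bullet> \<phi> p = 0"
    using normal_inner_tropical[OF X \<psi> \<phi>] by (simp add: scale_normal_section)
qed (simp add: scale_fun_def normal_section_def)

lemma second_variation_form_normal:
  fixes a :: real
  defines "V \<equiv> scale_fun a (normal_section X \<psi>)"
  assumes "compact (points X)"
  shows "second_variation_form X \<phi> V V =
    - 4 * (real CARD('m))\<^sup>2 * a\<^sup>2 * measure (volume X) (points X)"
proof -
  have "second_variation X \<phi> V p \<bullet> V p = - 4 * (real CARD('m))\<^sup>2 * a\<^sup>2" if p: "p \<in> points X" for p
  proof -
    have "second_variation X \<phi> V p = (- 4 * (real CARD('m))\<^sup>2 * a) *\<^sub>R tropical_normal \<psi> p"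
      unfolding V_def by (rule second_variation_normal[OF X \<psi> \<phi> scale_normal_section p])
    then show ?thesis
      by (simp add: V_def scale_normal_section[OF p] normal_inner_self[OF X \<psi> \<phi> p] power2_eq_square)
  qed
  then have "second_variation_form X \<phi> V V = (LINT p|volume X. - 4 * (real CARD('m))\<^sup>2 * a\<^sup>2)"
    unfolding second_variation_form_def
    by (intro Bochner_Integration.integral_cong refl) (simp add: space_volume[OF X assms(2)])
  then show ?thesis
    by (simp add: space_volume[OF X assms(2)])
qed

lemma negative_space_normal:
  assumes "compact (points X)" "points X \<noteq> {}"
  shows "negative_space X \<phi> (fun_span {normal_section X \<psi>})"
  unfolding negative_space_def
proof (intro conjI ballI impI)
  have "measure (volume X) (points X) > 0"
    using volume_finite[OF X assms(1)] volume_nonzero[OF X assms]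
    by (simp add: measure_def enn2real_positive_iff zero_less_iff_neq_zero less_top)
  moreover fix V assume "V \<in> fun_span {normal_section X \<psi>}"
  then obtain a where V: "V = scale_fun a (normal_section X \<psi>)"
    by (auto simp: fun_space.span_singleton)
  show "smooth_section X \<phi> V"
    unfolding V by (rule smooth_section_normal)
  assume "V \<noteq> 0"
  then have "a \<noteq> 0"
    using V by auto
  ultimately show "second_variation_form X \<phi> V V < 0"
    unfolding V second_variation_form_normal[OF assms(1)] by simp
qed (rule fun_space.subspace_span)

lemma index_pos:
  assumes "compact (points X)" "points X \<noteq> {}"
  shows "index X \<phi> > 0"
proof -
  let ?W = "normal_section X \<psi>"
  obtain p where p: "p \<in> points X" using assms(2) by blast
  have "?W p \<noteq> 0"
    using normal_inner_self[OF X \<psi> \<phi> p] p by (auto simp: normal_section_def)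
  then have "?W \<noteq> 0" by auto
  then have "fun_dim (fun_span {?W}) = 1"
    using fun_space.dim_eq_card_independent[of "{?W}"] by (simp add: fun_space.dim_span)
  moreover have "enat (fun_dim (fun_span {?W})) \<le> index X \<phi>"
    unfolding index_def by (rule SUP_upper) (use negative_space_normal[OF assms] in blast)
  ultimately have "enat 1 \<le> index X \<phi>"
    by simp
  moreover have "0 < enat 1"
    by (simp add: zero_enat_def)
  ultimately show ?thesis
    by (rule less_le_trans[rotated])
qed

end

theorem theorem2p1:
  fixes X :: "('p::t2_space, 'm::finite) riem"
    and \<psi> :: "'p \<Rightarrow> 'a::euclidean_space"
    and \<phi> :: "'p \<Rightarrow> 'a \<times> real"
  assumes "compact_riemannian_manifold X"
    and "minimal_isometric_immersion X (1 / sqrt 2) \<psi>"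
    and "\<phi> = tropical_inclusion \<circ> \<psi>"
    and "biharmonic X \<phi>"
    and "\<not> harmonic X \<phi>"
  shows "index X \<phi> > 0 \<and> unstable X \<phi>"
proof -
  have X: "smooth_manifold X" "riemannian_metric X" "compact (points X)"
    using assms(1) by (auto simp: compact_riemannian_manifold_def)
  \<comment> \<open>On the empty manifold every map would be harmonic.\<close>
  have "points X \<noteq> {}"
    using assms(4,5) by (auto simp: biharmonic_def harmonic_def)
  then have "index X \<phi> > 0"
    by (rule index_pos[OF X(1,2) assms(2,3) X(3)])
  then show ?thesis
    by (simp add: stable_def)
qed

end
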